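(* Let $W=\{W(t):t\in[a,b]\}$ be a standard Brownian motion and let $L$ be the weak random operator $\langle Lf,h\rangle:=\varepsilon(f,h)=-\int_a^b \frac{f'(t)h'(t)}{2}\,dt-\int_a^b\frac{f'(t)h(t)}{2}\,dW(t)$. Almost surely, $L$ has a discrete spectrum in the following weak sense: the relation $$\langle Le,h\rangle=\langle\lambda e,h\rangle\quad\text{for all }h\in H_1$$ holds, with some nonzero $e\in H_1$ (for which $\varepsilon(e,h)$ is defined in the pathwise sense of the convention on $dW$-integrals), for a countable number of $\lambda\in\mathbb{R}$.
   Context: Fix real numbers $a<b$ and a standard Brownian motion $W=\{W(t):t\in[a,b]\}$ with continuous paths. Write $\langle f,g\rangle=\int_a^b f(x)g(x)\,dx$ for the inner product of $L_2[a,b]$. Let $H_1$ be the Sobolev space of absolutely continuous functions $h:[a,b]\to\mathbb{R}$ with $h,h'\in L_2[a,b]$ and $h(a)=h(b)=0$. The operator $L$ is formally $(Lf)(t)=\frac{f''(t)}{2}-\frac{W'(t)f'(t)}{2}$; it is given rigorous meaning only through the bilinear form $\varepsilon$ in the claim, where $\langle Lf,h\rangle$ is just notation for $\varepsilon(f,h)$. The numbers $\lambda$ and functions $e$ may depend on the realization of $W$. Convention on $dW$-integrals: put $E(t):=e^{W(t)-t/2}$, so that $dE=E\,dW$ by Itô's formula. For integrands of the form $E(t)g(t)$, with $g$ absolutely continuous and possibly depending on the whole path of $W$, the integral is understood path by path through integration by parts, $$\int_a^b E(t)g(t)\,dW(t):=E(b)g(b)-E(a)g(a)-\int_a^b E(t)g'(t)\,dt,$$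 which agrees with the Itô integral for adapted $g$. Accordingly, $\varepsilon(e,h)$ is defined in this pathwise sense for all $h\in H_1$ when $e\in H_1$ and $e'=Eg$ with $g$ absolutely continuous. *)

theory Defs
  imports "HOL-Probability.Probability"
begin

section \<open>Brownian motion\<close>

text \<open>
  The time set \<open>T\<close> and the origin \<open>t0\<close> (where the motion vanishes) are parameters: \<open>T = {0..}\<close> and
  \<open>T = UNIV\<close> with \<open>t0 = 0\<close> give the one-sided and the two-sided standard Brownian motion, and
  \<open>T = {a..b}\<close> with \<open>t0 = a\<close> the standard Brownian motion started at the left end point.
\<close>

definition standard_brownian_motion ::
  "'w measure \<Rightarrow> real set \<Rightarrow> real \<Rightarrow> (real \<Rightarrow> 'w \<Rightarrow> real) \<Rightarrow> bool" where
  "standard_brownian_motion M T t0 W \<longleftrightarrow>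
     prob_space M \<and>
     (\<forall>t\<in>T. W t \<in> borel_measurable M) \<and>
     t0 \<in> T \<and> (AE \<omega> in M. W t0 \<omega> = 0) \<and>
     (\<forall>(\<tau> :: nat \<Rightarrow> real) n. (\<forall>i\<le>n. \<tau> i \<in> T) \<and> strict_mono_on {..n} \<tau> \<longrightarrow>
        prob_space.indep_vars M (\<lambda>_. borel) (\<lambda>i \<omega>. W (\<tau> (Suc i)) \<omega> - W (\<tau> i) \<omega>) {..<n}) \<and>
     (\<forall>s\<in>T. \<forall>t\<in>T. s < t \<longrightarrow>
        distributed M lborel (\<lambda>\<omega>. W t \<omega> - W s \<omega>) (normal_density 0 (sqrt (t - s)))) \<and>
     (\<forall>\<omega>\<in>space M. continuous_on T (\<lambda>t. W t \<omega>))"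

section \<open>Function spaces on a compact interval\<close>

definition abs_continuous :: "real \<Rightarrow> real \<Rightarrow> (real \<Rightarrow> real) \<Rightarrow> bool" where
  "abs_continuous a b f \<longleftrightarrow>
     (\<forall>\<epsilon>>0. \<exists>\<delta>>0. \<forall>(n::nat) (u :: nat \<Rightarrow> real) v.
        (\<forall>i<n. a \<le> u i \<and> u i \<le> v i \<and> v i \<le> b) \<and>
        disjoint_family_on (\<lambda>i. {u i<..<v i}) {..<n} \<and>
        (\<Sum>i<n. v i - u i) < \<delta> \<longrightarrow>
        (\<Sum>i<n. \<bar>f (v i) - f (u i)\<bar>) < \<epsilon>)"

definition L2 :: "real \<Rightarrow> real \<Rightarrow> (real \<Rightarrow> real) set" where
  "L2 a b = {f. f \<in> borel_measurable (lebesgue_on {a..b}) \<and>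
                integrable (lebesgue_on {a..b}) (\<lambda>x. (f x)\<^sup>2)}"

definition inner_L2 :: "real \<Rightarrow> real \<Rightarrow> (real \<Rightarrow> real) \<Rightarrow> (real \<Rightarrow> real) \<Rightarrow> real" where
  "inner_L2 a b f g = (LINT x|lebesgue_on {a..b}. f x * g x)"

text \<open>
  Functions on \<open>[a, b]\<close> are represented by total functions whose values off \<open>[a, b]\<close> are irrelevant.
  An absolutely continuous function is differentiable almost everywhere on \<open>[a, b]\<close>, so \<^const>\<open>deriv\<close>
  is its derivative up to a null set (which contains the end points).
\<close>

definition H1 :: "real \<Rightarrow> real \<Rightarrow> (real \<Rightarrow> real) set" where
  "H1 a b = {h. abs_continuous a b h \<and> h \<in> L2 a b \<and> deriv h \<in> L2 a b \<and> h a = 0 \<and> h b = 0}"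

section \<open>The pathwise stochastic integral and the weak operator\<close>

text \<open>Here \<open>w\<close> is a single path \<open>t \<mapsto> W t \<omega>\<close>.\<close>

definition ito_exp :: "(real \<Rightarrow> real) \<Rightarrow> real \<Rightarrow> real" where
  "ito_exp w t = exp (w t - t / 2)"

definition ac_factor ::
  "real \<Rightarrow> real \<Rightarrow> (real \<Rightarrow> real) \<Rightarrow> (real \<Rightarrow> real) \<Rightarrow> (real \<Rightarrow> real) \<Rightarrow> bool" where
  "ac_factor a b w f g \<longleftrightarrow>
     abs_continuous a b g \<and> (AE t in lebesgue_on {a..b}. f t = ito_exp w t * g t)"

text \<open>
  The integral of \<open>f\<close> against \<open>dw\<close>, meaningful only if \<open>f\<close> has an absolutely continuous factor \<open>g\<close>.
  The choice of \<open>g\<close> is immaterial, see \<open>dW_integral_eq\<close> below.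
\<close>

definition dW_integral :: "real \<Rightarrow> real \<Rightarrow> (real \<Rightarrow> real) \<Rightarrow> (real \<Rightarrow> real) \<Rightarrow> real" where
  "dW_integral a b w f =
     (let g = (SOME g. ac_factor a b w f g) in
        ito_exp w b * g b - ito_exp w a * g a
          - (LINT t|lebesgue_on {a..b}. ito_exp w t * deriv g t))"

definition weak_L ::
  "real \<Rightarrow> real \<Rightarrow> (real \<Rightarrow> real) \<Rightarrow> (real \<Rightarrow> real) \<Rightarrow> (real \<Rightarrow> real) \<Rightarrow> real" where
  "weak_L a b w f h =
     - (LINT t|lebesgue_on {a..b}. deriv f t * deriv h t / 2)
     - dW_integral a b w (\<lambda>t. deriv f t * h t / 2)"

definition weak_L_domain :: "real \<Rightarrow> real \<Rightarrow> (real \<Rightarrow> real) \<Rightarrow> (real \<Rightarrow> real) set" where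
  "weak_L_domain a b w = {e \<in> H1 a b. \<exists>g. ac_factor a b w (deriv e) g}"

definition weak_eigenvalues :: "real \<Rightarrow> real \<Rightarrow> (real \<Rightarrow> real) \<Rightarrow> real set" where
  "weak_eigenvalues a b w =
     {l. \<exists>e \<in> weak_L_domain a b w. (\<exists>t\<in>{a..b}. e t \<noteq> 0) \<and>
           (\<forall>h \<in> H1 a b. weak_L a b w e h = inner_L2 a b (\<lambda>t. l * e t) h)}"

section \<open>Well-definedness of the pathwise integral\<close>

lemma abs_continuous_imp_continuous_on:
  assumes "abs_continuous a b f"
  shows "continuous_on {a..b} f"
proof -
  have "\<exists>d>0. \<forall>y\<in>{a..b}. dist y x < d \<longrightarrow> dist (f y) (f x) < e"
    if x: "x \<in> {a..b}" and e: "e > 0" for x e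
  proof -
    obtain d where d: "d > 0" and D: "\<And>(n::nat) (u :: nat \<Rightarrow> real) v.
        (\<forall>i<n. a \<le> u i \<and> u i \<le> v i \<and> v i \<le> b) \<and>
        disjoint_family_on (\<lambda>i. {u i<..<v i}) {..<n} \<and>
        (\<Sum>i<n. v i - u i) < d \<Longrightarrow> (\<Sum>i<n. \<bar>f (v i) - f (u i)\<bar>) < e"
      using assms e unfolding abs_continuous_def by meson
    have "dist (f y) (f x) < e" if y: "y \<in> {a..b}" "dist y x < d" for y
      using D[of 1 "\<lambda>_. min x y" "\<lambda>_. max x y"] x y
      by (cases "x \<le> y") (auto simp: disjoint_family_on_def dist_real_def abs_minus_commute)
    with d show ?thesis by blast
  qed
  then show ?thesis by (auto simp: continuous_on_iff)
qed

lemma ac_factor_unique: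
  assumes "a < b" "ac_factor a b w f g1" "ac_factor a b w f g2" "t \<in> {a..b}"
  shows "g1 t = g2 t"
proof -
  let ?C = "{x \<in> {a..b}. g1 x = g2 x}"
  have cont: "continuous_on {a..b} g1" "continuous_on {a..b} g2"
    using assms(2,3) abs_continuous_imp_continuous_on by (auto simp: ac_factor_def)
  have C: "closed ?C"
    by (rule continuous_closed_preimage_constant[where f = "\<lambda>x. g1 x - g2 x" and a = 0, simplified])
       (auto intro!: continuous_intros cont)
  have "AE x in lebesgue_on {a..b}. g1 x = g2 x"
    using assms(2,3) unfolding ac_factor_def by (auto simp: ito_exp_def)
  then have "AE x in lebesgue. x \<in> {a..b} \<longrightarrow> g1 x = g2 x"
    by (subst (asm) AE_restrict_space_iff) auto
  then have "AE x\<in>{a<..<b} in lebesgue. x \<in> ?C"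
    by eventually_elim auto
  then have "{a<..<b} \<subseteq> ?C"
    using mem_closed_if_AE_lebesgue_open[OF open_greaterThanLessThan C] by (intro subsetI)
  then have "closure {a<..<b} \<subseteq> ?C"
    using C closure_minimal by blast
  then show ?thesis using assms(1,4) by auto
qed

lemma dW_integral_eq:
  assumes "a < b" "ac_factor a b w f g"
  shows "dW_integral a b w f =
           ito_exp w b * g b - ito_exp w a * g a
             - (LINT t|lebesgue_on {a..b}. ito_exp w t * deriv g t)"
proof -
  define g' where "g' = (SOME g. ac_factor a b w f g)"
  have g': "ac_factor a b w f g'"
    unfolding g'_def by (rule someI[of _ g]) fact
  have eq: "g' t = g t" if "t \<in> {a..b}" for t
    using ac_factor_unique[OF assms(1) g' assms(2) that] .
  have "deriv g' t = deriv g t" if "t \<in> {a<..<b}" for t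
  proof (rule deriv_cong_ev)
    show "\<forall>\<^sub>F x in nhds t. g' x = g x"
      using eventually_nhds_in_open[OF open_greaterThanLessThan that]
      by eventually_elim (auto intro: eq)
  qed simp
  moreover have "AE t in lebesgue. t \<notin> {a, b}"
    by (rule AE_not_in) (simp add: null_sets_completionI)
  ultimately have "AE t in lebesgue. t \<in> {a..b} \<longrightarrow> deriv g' t = deriv g t"
    by (elim eventually_mono) auto
  then have AEq: "AE t in lebesgue. indicat_real {a..b} t *\<^sub>R (ito_exp w t * deriv g' t) =
      indicat_real {a..b} t *\<^sub>R (ito_exp w t * deriv g t)" (is "AE t in _. ?u t = ?v t")
    by eventually_elim (auto simp: indicator_def split: if_splits)
  have "integral\<^sup>L lebesgue ?u = integral\<^sup>L lebesgue ?v"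
  proof (cases "?u \<in> borel_measurable lebesgue")
    case True
    then have "?v \<in> borel_measurable lebesgue"
      using AEq by (rule borel_measurable_AE)
    with True AEq show ?thesis by (intro integral_cong_AE)
  next
    case False
    moreover have "?v \<notin> borel_measurable lebesgue"
    proof
      assume "?v \<in> borel_measurable lebesgue"
      moreover have "AE t in lebesgue. ?v t = ?u t" using AEq by eventually_elim (rule sym)
      ultimately have "?u \<in> borel_measurable lebesgue" by (rule borel_measurable_AE)
      with False show False ..
    qed
    ultimately have "\<not> integrable lebesgue ?u" "\<not> integrable lebesgue ?v"
      using borel_measurable_integrable by blast+
    then show ?thesis using not_integrable_integral_eq[of lebesgue ?u] not_integrable_integral_eq[of lebesgue ?v] by argo
  qed
  then have "(LINT t|lebesgue_on {a..b}. ito_exp w t * deriv g' t) =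
      (LINT t|lebesgue_on {a..b}. ito_exp w t * deriv g t)"
    by (simp add: integral_restrict_space)
  with eq[of a] eq[of b] assms(1) show ?thesis
    unfolding dW_integral_def g'_def[symmetric] Let_def by simp
qed

end

theory Submission
  imports Defs
begin

text \<open>
  Fix a continuous path and put \<open>E = ito_exp w\<close>. If \<open>e' = E g\<close> with \<open>g\<close> absolutely continuous, the
  pathwise integral reduces \<open>\<epsilon>(e, h)\<close> to \<open>\<integral> E g' h / 2\<close>, so that the weak eigenvalues are those of the
  regular Sturm-Liouville problem \<open>e' = E g\<close>, \<open>g' = 2 \<lambda> e / E\<close>, \<open>e(a) = e(b) = 0\<close>, whose coefficients are
  merely continuous. The reduction needs Lebesgue's theorem that absolutely continuous functions are
  differentiable almost everywhere and are the integrals of their derivatives.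

  There are countably many eigenvalues because eigenfunctions are orthogonal with weight \<open>1/E\<close>: by Bessel's
  inequality each indicator of \<open>[a, q]\<close>, \<open>q\<close> rational, has only countably many non-zero coefficients, and
  no eigenfunction is orthogonal to all of these indicators. There are infinitely many because for
  \<open>\<lambda> = - s\<^sup>2 / 2\<close> the Pruefer angle satisfies \<open>\<theta>' = s (E cos\<^sup>2 \<theta> + sin\<^sup>2 \<theta> / E)\<close>, so \<open>\<theta>(b)\<close> is continuous
  in \<open>s\<close>, vanishes at \<open>s = 0\<close> and grows at least linearly, hence takes every value \<open>n \<pi>\<close>.
\<close>

section \<open>Differentiability of monotone functions\<close>

text \<open>The weak equation speaks of \<open>deriv\<close> only almost everywhere, and
  \<open>e\<close> and the factor \<open>g\<close> are at first merely absolutely continuous.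
  Classical solutions come back because a derivative that agrees almost everywhere with a continuous
  function agrees with it everywhere. For \<open>g\<close> the obstacle is that E is as rough as the
  path: the natural test function \<rho>/E need not lie in \<open>H1\<close>, so the vanishing of
  the test integrals is first extended from \<open>H1\<close> to continuous functions that vanish at
  both ends. Lebesgue's theorem is reached through monotone functions: absolute continuity makes the
  variation small on short intervals, so the function is locally a difference of monotone continuous
  functions, and Vitali coverings show that the points where the derivates of such functions are
  infinite or disagree form a null set. In the Pruefer variables e = \<rho> sin \<theta>, g = s
  \<rho> cos \<theta> the extra factor s turns the system into e' = s E (g/s), (g/s)' = - s e/E.
  Thus s becomes a common factor of the angle equation, and what it multiplies is bounded below by a
  positive constant. Distinct values of \<theta>(b) come from distinct s, hence from distinct
  eigenvalues.\<close>

definition frequent_slope :: "(real \<Rightarrow> real) \<Rightarrow> (real \<Rightarrow> bool) \<Rightarrow> real \<Rightarrow> bool" where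
  "frequent_slope F P x \<longleftrightarrow>
     (\<forall>d>0. \<exists>u v. u \<le> x \<and> x \<le> v \<and> u < v \<and> v - u < d \<and> P ((F v - F u) / (v - u)))"

lemma frequent_slope_cover:
  fixes U :: "real set"
  assumes "open U" "\<And>x. x \<in> S \<Longrightarrow> x \<in> U \<and> frequent_slope F P x"
  obtains C :: "(real \<times> real) set" where "countable C"
    "\<And>u v. (u, v) \<in> C \<Longrightarrow> u < v \<and> {u..v} \<subseteq> U \<and> P ((F v - F u) / (v - u))"
    "disjoint_family_on (\<lambda>(u, v). {u..v}) C"
    "negligible (S - (\<Union>(u, v)\<in>C. {u..v}))"
proof -
  define K where "K = {(u, v). u < v \<and> {u..v} \<subseteq> U \<and> P ((F v - F u) / (v - u))}"
  define m r :: "real \<times> real \<Rightarrow> real" where "m = (\<lambda>(u, v). (u + v) / 2)" and "r = (\<lambda>(u, v). (v - u) / 2)"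
  have cb: "cball (m i) (r i) = (case i of (u, v) \<Rightarrow> {u..v})" for i
    by (auto simp: m_def r_def cball_eq_atLeastAtMost field_simps split: prod.splits)
  have pos: "\<And>i. i \<in> K \<Longrightarrow> 0 < r i" by (auto simp: K_def r_def)
  have "\<exists>i. i \<in> K \<and> x \<in> cball (m i) (r i) \<and> r i < d" if x: "x \<in> S" and d: "0 < d" for x d
  proof -
    obtain e where e: "e > 0" "ball x e \<subseteq> U"
      using assms x by (metis open_contains_ball)
    obtain u v where uv: "u \<le> x" "x \<le> v" "u < v" "v - u < min d e" "P ((F v - F u) / (v - u))"
      using assms(2)[OF x] d e(1) unfolding frequent_slope_def by (metis min_less_iff_conj)
    have "{u..v} \<subseteq> ball x e" using uv by (auto simp: dist_real_def)
    then have "(u, v) \<in> K" using uv e by (auto simp: K_def)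
    then show ?thesis using uv unfolding cb by (intro exI[of _ "(u, v)"]) (auto simp: r_def)
  qed
  with pos obtain C where "countable C" "C \<subseteq> K"
     "pairwise (\<lambda>i j. disjnt (cball (m i) (r i)) (cball (m j) (r j))) C"
     "negligible (S - (\<Union>i \<in> C. cball (m i) (r i)))"
    by (rule Vitali_covering_theorem_cballs[of K r S m]) auto
  then show ?thesis
    unfolding cb by (intro that[of C]) (auto simp: K_def disjoint_family_on_def pairwise_def disjnt_def)
qed

lemma emeasure_disjoint_intervals:
  fixes C :: "(real \<times> real) set"
  assumes C: "countable C" "disjoint_family_on (\<lambda>(u, v). {u..v}) C" "\<And>u v. (u, v) \<in> C \<Longrightarrow> u < v"
    and sets: "sets M = sets borel"
  shows "emeasure M (\<Union>(u, v)\<in>C. {u..v}) = (\<integral>\<^sup>+(u, v). emeasure M {u..v} \<partial>count_space C)"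
proof -
  have "emeasure M (\<Union>i\<in>C. (\<lambda>(u, v). {u..v}) i) = (\<integral>\<^sup>+i. emeasure M ((\<lambda>(u, v). {u..v}) i) \<partial>count_space C)"
    by (rule emeasure_UN_countable) (use C sets in auto)
  then show ?thesis by (simp add: case_prod_unfold)
qed

lemma countable_imp_negligible:
  fixes S :: "real set"
  shows "countable S \<Longrightarrow> negligible S"
  unfolding negligible_iff_null_sets by (intro null_sets_completionI countable_imp_null_set_lborel)

lemma emeasure_lborel_eq_measure:
  assumes "A \<in> lmeasurable" "A \<in> sets borel"
  shows "emeasure lborel A = ennreal (measure lebesgue A)"
  using emeasure_eq_measure2[OF assms(1)] assms(2) by simp

context
  fixes F :: "real \<Rightarrow> real" and p :: real
  assumes F: "mono F" "continuous_on UNIV F" and p: "0 \<le> p"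
begin

text \<open>Continuity of \<open>F\<close> gives
  \<open>interval_measure F {u..v} = F v - F u\<close> for closed intervals, so a slope bound
  compares this measure with \<open>p\<close> times the length on each interval; disjointness sums
  the comparison.\<close>

lemma interval_measure_union_le:
  fixes C :: "(real \<times> real) set"
  assumes C: "countable C" "disjoint_family_on (\<lambda>(u, v). {u..v}) C"
    and le: "\<And>u v. (u, v) \<in> C \<Longrightarrow> u < v \<and> (F v - F u) / (v - u) \<le> p"
  shows "emeasure (interval_measure F) (\<Union>(u, v)\<in>C. {u..v}) \<le> ennreal p * emeasure lborel (\<Union>(u, v)\<in>C. {u..v})"
proof -
  have "emeasure (interval_measure F) (\<Union>(u, v)\<in>C. {u..v})
      = (\<integral>\<^sup>+(u, v). emeasure (interval_measure F) {u..v} \<partial>count_space C)"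
    by (rule emeasure_disjoint_intervals) (use C le in auto)
  also have "\<dots> \<le> (\<integral>\<^sup>+(u, v). ennreal p * emeasure lborel {u..v} \<partial>count_space C)"
  proof (rule nn_integral_mono)
    fix x assume "x \<in> space (count_space C)"
    then obtain u v where x: "x = (u, v)" "(u, v) \<in> C" by (cases x) auto
    have "F v - F u \<le> p * (v - u)" using le[OF x(2)] by (auto simp: field_simps)
    moreover have "emeasure (interval_measure F) {u..v} = ennreal (F v - F u)"
      using le[OF x(2)] F by (intro emeasure_interval_measure_Icc) (auto dest: monoD)
    ultimately show "(case x of (u, v) \<Rightarrow> emeasure (interval_measure F) {u..v})
        \<le> (case x of (u, v) \<Rightarrow> ennreal p * emeasure lborel {u..v})"
      using le[OF x(2)] p by (simp add: x(1) ennreal_mult'[symmetric] ennreal_leI)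
  qed
  also have "\<dots> = ennreal p * emeasure lborel (\<Union>(u, v)\<in>C. {u..v})"
    using C le by (subst emeasure_disjoint_intervals) (auto simp: case_prod_unfold nn_integral_cmult)
  finally show ?thesis .
qed

lemma interval_measure_union_ge:
  fixes C :: "(real \<times> real) set"
  assumes C: "countable C" "disjoint_family_on (\<lambda>(u, v). {u..v}) C"
    and ge: "\<And>u v. (u, v) \<in> C \<Longrightarrow> u < v \<and> (F v - F u) / (v - u) \<ge> p"
  shows "ennreal p * emeasure lborel (\<Union>(u, v)\<in>C. {u..v}) \<le> emeasure (interval_measure F) (\<Union>(u, v)\<in>C. {u..v})"
proof -
  have "ennreal p * emeasure lborel (\<Union>(u, v)\<in>C. {u..v})
      = (\<integral>\<^sup>+(u, v). ennreal p * emeasure lborel {u..v} \<partial>count_space C)"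
    using C ge by (subst emeasure_disjoint_intervals) (auto simp: case_prod_unfold nn_integral_cmult)
  also have "\<dots> \<le> (\<integral>\<^sup>+(u, v). emeasure (interval_measure F) {u..v} \<partial>count_space C)"
  proof (rule nn_integral_mono)
    fix x assume "x \<in> space (count_space C)"
    then obtain u v where x: "x = (u, v)" "(u, v) \<in> C" by (cases x) auto
    have "F v - F u \<ge> p * (v - u)" using ge[OF x(2)] by (auto simp: field_simps)
    moreover have "emeasure (interval_measure F) {u..v} = ennreal (F v - F u)"
      using ge[OF x(2)] F by (intro emeasure_interval_measure_Icc) (auto dest: monoD)
    ultimately show "(case x of (u, v) \<Rightarrow> ennreal p * emeasure lborel {u..v})
        \<le> (case x of (u, v) \<Rightarrow> emeasure (interval_measure F) {u..v})"
      using ge[OF x(2)] p by (simp add: x(1) ennreal_mult'[symmetric] ennreal_leI)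
  qed
  also have "\<dots> = emeasure (interval_measure F) (\<Union>(u, v)\<in>C. {u..v})"
    by (rule emeasure_disjoint_intervals[symmetric]) (use C ge in auto)
  finally show ?thesis .
qed

end

text \<open>Disjoint intervals in \<open>{c<..<d}\<close> with slopes above \<open>q\<close> have
  total length at most \<open>(F d - F c) / q\<close>, and by Vitali they cover almost all of the
  set. Letting \<open>q\<close> grow makes the length arbitrarily small.\<close>

lemma negligible_infinite_slope:
  fixes F :: "real \<Rightarrow> real"
  assumes F: "mono F" "continuous_on UNIV F"
  shows "negligible {x \<in> {c<..<d}. \<forall>q. frequent_slope F (\<lambda>s. s > q) x}" (is "negligible ?S")
proof (cases "c < d")
  case cd: True
  define K where "K = F d - F c"
  have K: "K \<ge> 0" using F(1) cd by (auto simp: K_def dest: monoD[of _ c d])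
  show ?thesis unfolding negligible_outer_le
  proof (intro allI impI)
    fix e :: real assume e: "e > 0"
    \<comment> \<open>Chosen so that \<open>K / q \<le> e\<close>; the summand 1 keeps
      \<open>q\<close> positive when \<open>K = 0\<close>.\<close>
    define q where "q = K / e + 1"
    have q: "q > 0" using K e by (simp add: q_def add_nonneg_pos)
    obtain C where C: "countable C"
      "\<And>u v. (u, v) \<in> C \<Longrightarrow> u < v \<and> {u..v} \<subseteq> {c<..<d} \<and> (F v - F u) / (v - u) > q"
      "disjoint_family_on (\<lambda>(u, v). {u..v}) C" "negligible (?S - (\<Union>(u, v)\<in>C. {u..v}))"
      by (rule frequent_slope_cover[of "{c<..<d}" ?S F "\<lambda>s. s > q"]) auto
    define A where "A = (\<Union>(u, v)\<in>C. {u..v})"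
    have Ab: "A \<in> sets borel" unfolding A_def using C(1) by (intro sets.countable_UN') auto
    have sub: "A \<subseteq> {c..d}" unfolding A_def using C(2) by fastforce
    have "ennreal q * emeasure lborel A \<le> emeasure (interval_measure F) A"
      unfolding A_def using q C F by (intro interval_measure_union_ge) (auto intro: less_imp_le)
    also have "\<dots> \<le> emeasure (interval_measure F) {c..d}"
      using sub by (intro emeasure_mono) auto
    also have "\<dots> = ennreal K"
      using cd F unfolding K_def by (intro emeasure_interval_measure_Icc) (auto dest: monoD)
    finally have le: "ennreal q * emeasure lborel A \<le> ennreal K" .
    have fin: "emeasure lborel A < \<infinity>"
      by (rule le_less_trans[OF emeasure_mono[OF sub]]) (auto simp: emeasure_lborel_Icc_eq)
    have Am: "A \<in> lmeasurable" using Ab fin by (intro fmeasurableI) simp_all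
    have "emeasure lborel A = ennreal (measure lebesgue A)"
      by (rule emeasure_lborel_eq_measure) fact+
    with le q have "q * measure lebesgue A \<le> K"
      using K by (simp add: ennreal_mult'[symmetric])
    then have "measure lebesgue A \<le> K / q" using q by (simp add: field_simps)
    also have "\<dots> \<le> e" using q e K by (simp add: q_def field_simps)
    finally have "measure lebesgue A \<le> e" .
    moreover have "measure lebesgue (A \<union> (?S - A)) = measure lebesgue A"
      using C(4)[folded A_def] Am
      by (intro measure_Un_null_set fmeasurableD) (simp_all only: negligible_iff_null_sets)
    moreover have "A \<union> (?S - A) \<in> lmeasurable"
      using Am C(4)[folded A_def] by (intro fmeasurable.Un) (auto intro: negligible_imp_measurable)
    ultimately show "\<exists>T. ?S \<subseteq> T \<and> T \<in> lmeasurable \<and> measure lebesgue T \<le> e"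
      by (intro exI[of _ "A \<union> (?S - A)"]) auto
  qed
qed simp

text \<open>Let \<open>m\<close> be the outer measure of the set. Cover it inside an open set of
  measure at most \<open>m + e\<close> by intervals with slope below \<open>p\<close>, then cover it
  again, inside the interiors of these, by intervals with slope above \<open>q\<close>. Comparing
  the \<open>F\<close>-masses of the two families gives \<open>q * m \<le> p * (m + e)\<close> for
  all \<open>e > 0\<close>, which forces \<open>m = 0\<close> because \<open>p < q\<close>.\<close>

lemma negligible_two_slopes:
  fixes F :: "real \<Rightarrow> real"
  assumes F: "mono F" "continuous_on UNIV F" and pq: "p < q"
  shows "negligible {x \<in> {c<..<d}. frequent_slope F (\<lambda>s. s < p) x \<and> frequent_slope F (\<lambda>s. s > q) x}"
    (is "negligible ?S")
proof (cases "p > 0")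
  case False
  \<comment> \<open>Slopes of a monotone function are nonnegative, so for \<open>p \<le> 0\<close>
    there is nothing to cover.\<close>
  have "\<not> frequent_slope F (\<lambda>s. s < p) x" for x
  proof
    assume "frequent_slope F (\<lambda>s. s < p) x"
    then obtain u v where "u < v" "(F v - F u) / (v - u) < p"
      unfolding frequent_slope_def by (meson zero_less_one)
    moreover have "F u \<le> F v" using \<open>u < v\<close> by (intro monoD[OF F(1)]) simp
    ultimately show False using False by (smt (verit) divide_nonneg_pos)
  qed
  then show ?thesis by simp
next
  case p: True
  \<comment> \<open>The outer measure is formed by hand as an infimum over measurable supersets,
    since measurability of \<open>?S\<close> has not been established.\<close>
  define \<M> where "\<M> = {measure lebesgue T | T. ?S \<subseteq> T \<and> T \<in> lmeasurable}"
  define m where "m = Inf \<M>"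
  have ne: "\<M> \<noteq> {}" unfolding \<M>_def by (auto intro!: exI[of _ "{c..d}"])
  have bdd: "bdd_below \<M>" by (rule bdd_belowI[of _ 0]) (auto simp: \<M>_def)
  have m0: "m \<ge> 0" unfolding m_def using ne by (intro cInf_greatest) (auto simp: \<M>_def)
  have qp: "q * m \<le> p * (m + e)" if e: "e > 0" for e
  proof -
    have "Inf \<M> < m + e / 2" using e by (simp add: m_def)
    then obtain T where T: "?S \<subseteq> T" "T \<in> lmeasurable" "measure lebesgue T < m + e / 2"
      using cInf_lessD[OF ne] unfolding \<M>_def by blast
    obtain U0 where U0: "open U0" "T \<subseteq> U0" "U0 - T \<in> lmeasurable" "emeasure lebesgue (U0 - T) < ennreal (e / 2)"
      using sets_lebesgue_outer_open[of T "e / 2"] T(2) e by (auto simp: fmeasurableD)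
    have U0eq: "U0 = T \<union> (U0 - T)" using U0 by auto
    have U0m: "U0 \<in> lmeasurable" using T(2) U0(3) by (subst U0eq) (rule fmeasurable.Un)
    have "measure lebesgue (U0 - T) < e / 2"
      using U0(3,4) e by (simp add: emeasure_eq_measure2 ennreal_less_iff)
    then have U0l: "measure lebesgue U0 < measure lebesgue T + e / 2"
      using measure_Un_le[of T lebesgue "U0 - T"] T(2) U0(3) U0eq by (simp add: fmeasurableD)
    define U where "U = U0 \<inter> {c<..<d}"
    have U: "open U" "?S \<subseteq> U" using U0 T by (auto simp: U_def)
    have Um: "U \<in> lmeasurable" unfolding U_def using U0m by (intro fmeasurable_Int_fmeasurable) auto
    have Ul: "measure lebesgue U \<le> m + e"
      using measure_mono_fmeasurable[of U U0 lebesgue] U0m U0l T Um by (auto simp: U_def fmeasurableD)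
    obtain C where C: "countable C"
      "\<And>u v. (u, v) \<in> C \<Longrightarrow> u < v \<and> {u..v} \<subseteq> U \<and> (F v - F u) / (v - u) < p"
      "disjoint_family_on (\<lambda>(u, v). {u..v}) C" "negligible (?S - (\<Union>(u, v)\<in>C. {u..v}))"
      by (rule frequent_slope_cover[of U ?S F "\<lambda>s. s < p"]) (use U in auto)
    \<comment> \<open>The second covering needs an open set to live in, so it uses the open
      intervals \<open>B'\<close>; passing from \<open>B\<close> to \<open>B'\<close> loses only the
      countably many end points.\<close>
    define B B' where "B = (\<Union>(u, v)\<in>C. {u..v})" and "B' = (\<Union>(u, v)\<in>C. {u<..<v})"
    have "open B'" unfolding B'_def by auto
    then obtain D where D: "countable D"
      "\<And>u v. (u, v) \<in> D \<Longrightarrow> u < v \<and> {u..v} \<subseteq> B' \<and> (F v - F u) / (v - u) > q"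
      "disjoint_family_on (\<lambda>(u, v). {u..v}) D" "negligible (?S \<inter> B' - (\<Union>(u, v)\<in>D. {u..v}))"
      by (rule frequent_slope_cover[of B' "?S \<inter> B'" F "\<lambda>s. s > q"]) auto
    define A where "A = (\<Union>(u, v)\<in>D. {u..v})"
    have Ab: "A \<in> sets borel" unfolding A_def using D(1) by (intro sets.countable_UN') auto
    have Bb: "B \<in> sets borel" unfolding B_def using C(1) by (intro sets.countable_UN') auto
    have "B' \<subseteq> B" unfolding B_def B'_def by (intro UN_mono) auto
    then have AB: "A \<subseteq> B" unfolding A_def using D(2) by blast
    have BU: "B \<subseteq> U" unfolding B_def using C(2) by fastforce
    have "ennreal q * emeasure lborel A \<le> emeasure (interval_measure F) A"
      unfolding A_def using p pq D F by (intro interval_measure_union_ge) (auto intro: less_imp_le)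
    also have "\<dots> \<le> emeasure (interval_measure F) B"
      using AB Bb by (intro emeasure_mono) auto
    also have "\<dots> \<le> ennreal p * emeasure lborel B"
      unfolding B_def using p pq C F by (intro interval_measure_union_le) (auto intro: less_imp_le)
    also have "\<dots> \<le> ennreal p * emeasure lborel U"
      using BU U by (intro mult_left_mono emeasure_mono) auto
    also have "emeasure lborel U = ennreal (measure lebesgue U)"
      using Um U(1) by (intro emeasure_lborel_eq_measure borel_open)
    finally have le: "ennreal q * emeasure lborel A \<le> ennreal p * ennreal (measure lebesgue U)" .
    have "emeasure lborel A \<le> emeasure lborel U" using AB BU U(1) by (intro emeasure_mono) auto
    also have "\<dots> < \<infinity>" by (subst emeasure_lborel_eq_measure[OF Um borel_open[OF U(1)]]) simp
    finally have Am: "A \<in> lmeasurable" using Ab by (intro fmeasurableI) simp_all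
    have "emeasure lborel A = ennreal (measure lebesgue A)"
      by (rule emeasure_lborel_eq_measure) fact+
    with le p pq have "q * measure lebesgue A \<le> p * measure lebesgue U"
      by (simp add: ennreal_mult'[symmetric])
    also have "\<dots> \<le> p * (m + e)" using Ul p by simp
    finally have le': "q * measure lebesgue A \<le> p * (m + e)" .
    \<comment> \<open>Everything in \<open>?S\<close> that \<open>A\<close> may miss: the remainders
      of the two Vitali covers and the end points of the first family.\<close>
    let ?N = "(?S - B) \<union> ((?S \<inter> B' - A) \<union> (fst ` C \<union> snd ` C))"
    have "negligible (fst ` C \<union> snd ` C)" using C(1) by (intro countable_imp_negligible) auto
    then have N: "negligible ?N"
      by (intro negligible_Un[OF C(4)[folded B_def]] negligible_Un[OF D(4)[folded A_def]])
    have "?S \<subseteq> A \<union> ?N"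
    proof
      fix x assume x: "x \<in> ?S"
      show "x \<in> A \<union> ?N"
      proof (cases "x \<in> B \<and> x \<notin> B'")
        case True
        then obtain u v where uv: "(u, v) \<in> C" "x \<in> {u..v}" "x \<notin> {u<..<v}" by (auto simp: B_def B'_def)
        then have "x = u \<or> x = v" by auto
        with uv show ?thesis by force
      qed (use x in auto)
    qed
    moreover have "A \<union> ?N \<in> lmeasurable"
      using Am N by (intro fmeasurable.Un) (auto intro: negligible_imp_measurable)
    moreover have "measure lebesgue (A \<union> ?N) = measure lebesgue A"
      using N Am by (simp add: measure_Un_null_set negligible_iff_null_sets fmeasurableD)
    ultimately have "measure lebesgue A \<in> \<M>" unfolding \<M>_def by (auto intro!: exI[of _ "A \<union> ?N"])
    then have "m \<le> measure lebesgue A" unfolding m_def using bdd by (rule cInf_lower)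
    then show ?thesis using le' p pq by (smt (verit) mult_left_mono)
  qed
  have "q * m \<le> p * m"
  proof (rule field_le_epsilon)
    fix e :: real assume "e > 0"
    then have "q * m \<le> p * (m + e / p)" using p by (intro qp) simp
    then show "q * m \<le> p * m + e" using p by (simp add: distrib_left)
  qed
  then have m: "m = 0" using m0 pq p by (smt (verit) mult_right_mono mult_strict_right_mono)
  show ?thesis unfolding negligible_outer
  proof (intro allI impI)
    fix e :: real assume "e > 0"
    then have "Inf \<M> < e" using m by (simp add: m_def)
    then show "\<exists>T. ?S \<subseteq> T \<and> T \<in> lmeasurable \<and> measure lebesgue T < e"
      using cInf_lessD[OF ne] unfolding \<M>_def by blast
  qed
qed

text \<open>Compare the lower and upper limits \<open>l \<le> u\<close> of the difference quotient
  at \<open>x\<close>. If \<open>l < u\<close>, two rationals in between put \<open>x\<close> into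
  one of countably many null sets of two slopes; \<open>u = \<infinity>\<close> puts it into the
  null set of infinite slope. Otherwise the limit exists and is finite.\<close>

theorem mono_continuous_differentiable_ae:
  fixes F :: "real \<Rightarrow> real"
  assumes F: "mono F" "continuous_on UNIV F"
  shows "negligible {x \<in> {c<..<d}. \<nexists>D. (F has_real_derivative D) (at x)}"
proof -
  let ?I = "{x \<in> {c<..<d}. \<forall>q. frequent_slope F (\<lambda>s. s > q) x}"
  let ?T = "\<lambda>(p, q). {x \<in> {c<..<d}. frequent_slope F (\<lambda>s. s < p) x \<and> frequent_slope F (\<lambda>s. s > q) x}"
  let ?R = "{(p, q). p \<in> \<rat> \<and> q \<in> \<rat> \<and> p < q}"
  have "countable ?R"
    by (rule countable_subset[of _ "\<rat> \<times> \<rat>"]) (auto intro: countable_rat)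
  then have "negligible (?I \<union> (\<Union>i\<in>?R. ?T i))"
    using negligible_infinite_slope[OF F] negligible_two_slopes[OF F]
    by (intro negligible_Un negligible_countable_Union) (auto intro: countable_image)
  moreover have "\<exists>D. (F has_real_derivative D) (at x)"
    if x: "x \<in> {c<..<d}" and nI: "x \<notin> ?I" and nT: "x \<notin> (\<Union>i\<in>?R. ?T i)" for x
  proof -
    define Q where "Q y = (F y - F x) / (y - x)" for y
    define l u where "l = Liminf (at x) (\<lambda>y. ereal (Q y))" and "u = Limsup (at x) (\<lambda>y. ereal (Q y))"
    \<comment> \<open>A difference quotient at \<open>x\<close> is the slope of the interval with
      end points \<open>x\<close> and \<open>y\<close>, which is why \<open>frequent_slope\<close>
      admits \<open>x\<close> as an end point.\<close>
    have slope: "frequent_slope F P x" if "\<exists>\<^sub>F y in at x. P (Q y)" for P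
      unfolding frequent_slope_def
    proof (intro allI impI)
      fix e :: real assume "e > 0"
      then obtain y where y: "y \<noteq> x" "dist y x < e" "P (Q y)"
        using \<open>\<exists>\<^sub>F y in at x. P (Q y)\<close> by (auto simp: frequently_at)
      have "(F (max x y) - F (min x y)) / (max x y - min x y) = Q y"
        using y(1) by (cases "x < y") (auto simp: Q_def max_def min_def field_simps)
      then show "\<exists>u v. u \<le> x \<and> x \<le> v \<and> u < v \<and> v - u < e \<and> P ((F v - F u) / (v - u))"
        using y by (intro exI[of _ "min x y"] exI[of _ "max x y"]) (auto simp: dist_real_def)
    qed
    have lu: "l \<le> u" unfolding l_def u_def by (intro Liminf_le_Limsup) simp
    have "\<not> l < u"
    proof
      assume "l < u"
      then obtain p where p: "l < ereal p" "ereal p < u" by (meson ereal_dense2)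
      then obtain q where q: "ereal p < ereal q" "ereal q < u" by (meson ereal_dense2)
      then obtain p' where p': "p' \<in> \<rat>" "p < p'" "p' < q" by (meson Rats_dense_in_real ereal_less_eq(3) linorder_not_less)
      then obtain q' where q': "q' \<in> \<rat>" "p' < q'" "q' < q" by (meson Rats_dense_in_real)
      have "\<exists>\<^sub>F y in at x. Q y < p'"
      proof (rule ccontr)
        assume "\<not> ?thesis"
        then have "\<forall>\<^sub>F y in at x. ereal p' \<le> ereal (Q y)" by (simp add: frequently_def not_less)
        then have "ereal p' \<le> l" unfolding l_def by (rule Liminf_bounded)
        then have "ereal p' < ereal p" using p(1) by (rule le_less_trans)
        then show False using p' by simp
      qed
      moreover have "\<exists>\<^sub>F y in at x. q' < Q y"
      proof (rule ccontr)
        assume "\<not> ?thesis"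
        then have "\<forall>\<^sub>F y in at x. ereal (Q y) \<le> ereal q'" by (simp add: frequently_def not_less)
        then have "u \<le> ereal q'" unfolding u_def by (rule Limsup_bounded)
        then have "ereal q < ereal q'" using q(2) by (rule less_le_trans[rotated])
        then show False using q' by simp
      qed
      ultimately have "x \<in> ?T (p', q')" using x slope by auto
      then show False using nT p' q' by blast
    qed
    with lu have eq: "l = u" by simp
    have "\<forall>\<^sub>F y in at x. 0 \<le> ereal (Q y)"
    proof (intro always_eventually allI)
      fix y show "0 \<le> ereal (Q y)"
        using monoD[OF F(1), of x y] monoD[OF F(1), of y x]
        by (cases "x \<le> y") (auto simp: Q_def zero_le_divide_iff)
    qed
    then have "0 \<le> l" unfolding l_def by (rule Liminf_bounded)
    moreover have "u \<noteq> \<infinity>"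
    proof
      assume u: "u = \<infinity>"
      have "\<exists>\<^sub>F y in at x. q < Q y" for q
      proof (rule ccontr)
        assume "\<not> ?thesis"
        then have "\<forall>\<^sub>F y in at x. ereal (Q y) \<le> ereal q" by (simp add: frequently_def not_less)
        then have "u \<le> ereal q" unfolding u_def by (rule Limsup_bounded)
        then show False using u by simp
      qed
      then show False using nI x slope by auto
    qed
    ultimately obtain D where D: "u = ereal D" using eq by (cases u) auto
    have "((\<lambda>y. ereal (Q y)) \<longlongrightarrow> ereal D) (at x)"
      using eq D by (intro Liminf_eq_Limsup) (auto simp: l_def u_def)
    then have "(Q \<longlongrightarrow> D) (at x)" by simp
    then show ?thesis unfolding has_field_derivative_iff Q_def by blast
  qed
  ultimately show ?thesis by (elim negligible_subset) auto
qed

section \<open>Absolutely continuous functions\<close>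

lemma abs_continuous_subinterval:
  assumes "abs_continuous a b f" "a \<le> c" "d \<le> b"
  shows "abs_continuous c d f"
  unfolding abs_continuous_def
proof (intro allI impI)
  fix e :: real assume "e > 0"
  then obtain r where r: "r > 0" and R: "\<And>(n::nat) (u :: nat \<Rightarrow> real) v.
        (\<forall>i<n. a \<le> u i \<and> u i \<le> v i \<and> v i \<le> b) \<and>
        disjoint_family_on (\<lambda>i. {u i<..<v i}) {..<n} \<and>
        (\<Sum>i<n. v i - u i) < r \<Longrightarrow> (\<Sum>i<n. \<bar>f (v i) - f (u i)\<bar>) < e"
    using assms(1) unfolding abs_continuous_def by meson
  show "\<exists>r>0. \<forall>n (u :: nat \<Rightarrow> real) v.
        (\<forall>i<n. c \<le> u i \<and> u i \<le> v i \<and> v i \<le> d) \<and>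
        disjoint_family_on (\<lambda>i. {u i<..<v i}) {..<n} \<and>
        (\<Sum>i<n. v i - u i) < r \<longrightarrow> (\<Sum>i<n. \<bar>f (v i) - f (u i)\<bar>) < e"
    using r assms(2,3) by (intro exI[of _ r] conjI allI impI R) (auto intro: order_trans)
qed

lemma abs_continuous_lipschitz:
  assumes "\<And>x y. a \<le> x \<Longrightarrow> x \<le> y \<Longrightarrow> y \<le> b \<Longrightarrow> \<bar>f y - f x\<bar> \<le> K * (y - x)"
  shows "abs_continuous a b f"
  unfolding abs_continuous_def
proof (intro allI impI)
  fix e :: real assume e: "e > 0"
  define K' where "K' = max K 1"
  have K': "K' \<ge> 1" "K \<le> K'" by (auto simp: K'_def)
  show "\<exists>r>0. \<forall>n (u :: nat \<Rightarrow> real) v.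
        (\<forall>i<n. a \<le> u i \<and> u i \<le> v i \<and> v i \<le> b) \<and>
        disjoint_family_on (\<lambda>i. {u i<..<v i}) {..<n} \<and>
        (\<Sum>i<n. v i - u i) < r \<longrightarrow> (\<Sum>i<n. \<bar>f (v i) - f (u i)\<bar>) < e"
  proof (intro exI[of _ "e / K'"] conjI allI impI)
    show "e / K' > 0" using e K' by simp
    fix n :: nat and u v :: "nat \<Rightarrow> real"
    assume H: "(\<forall>i<n. a \<le> u i \<and> u i \<le> v i \<and> v i \<le> b) \<and>
        disjoint_family_on (\<lambda>i. {u i<..<v i}) {..<n} \<and> (\<Sum>i<n. v i - u i) < e / K'"
    have "(\<Sum>i<n. \<bar>f (v i) - f (u i)\<bar>) \<le> (\<Sum>i<n. K' * (v i - u i))"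
    proof (rule sum_mono)
      fix i assume "i \<in> {..<n}"
      then have "a \<le> u i" "u i \<le> v i" "v i \<le> b" using H by auto
      then have "\<bar>f (v i) - f (u i)\<bar> \<le> K * (v i - u i)" "K * (v i - u i) \<le> K' * (v i - u i)"
        using assms K' by (auto intro: mult_right_mono)
      then show "\<bar>f (v i) - f (u i)\<bar> \<le> K' * (v i - u i)" by linarith
    qed
    also have "\<dots> = K' * (\<Sum>i<n. v i - u i)" by (simp add: sum_distrib_left)
    also have "\<dots> < e" using H K' by (simp add: field_simps)
    finally show "(\<Sum>i<n. \<bar>f (v i) - f (u i)\<bar>) < e" .
  qed
qed

lemma abs_continuous_C1:
  fixes f f' :: "real \<Rightarrow> real"
  assumes "\<And>t. t \<in> {a..b} \<Longrightarrow> (f has_real_derivative f' t) (at t within {a..b})"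
    and "continuous_on {a..b} f'"
  shows "abs_continuous a b f"
proof -
  have "bounded (f' ` {a..b})"
    using assms(2) by (intro compact_imp_bounded compact_continuous_image) auto
  then obtain K where K: "\<And>t. t \<in> {a..b} \<Longrightarrow> \<bar>f' t\<bar> \<le> K"
    by (metis bounded_iff imageI real_norm_def)
  show ?thesis
  proof (rule abs_continuous_lipschitz)
    fix x y assume "a \<le> x" "x \<le> y" "y \<le> b"
    then show "\<bar>f y - f x\<bar> \<le> K * (y - x)"
      using field_differentiable_bound[of "{a..b}" f f' K x y] assms(1) K by auto
  qed
qed

lemma abs_continuous_mult:
  assumes "abs_continuous a b f" "abs_continuous a b g"
  shows "abs_continuous a b (\<lambda>x. f x * g x)"
  unfolding abs_continuous_def
proof (intro allI impI)
  fix e :: real assume e: "e > 0"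
  have "bounded (f ` {a..b})" "bounded (g ` {a..b})"
    using assms by (auto intro!: compact_imp_bounded compact_continuous_image abs_continuous_imp_continuous_on)
  then obtain A B where A: "\<And>t. t \<in> {a..b} \<Longrightarrow> \<bar>f t\<bar> \<le> A" and B: "\<And>t. t \<in> {a..b} \<Longrightarrow> \<bar>g t\<bar> \<le> B"
    by (metis bounded_iff imageI real_norm_def)
  define C where "C = max 1 (max A B)"
  have C: "C > 0" "A \<le> C" "B \<le> C" by (auto simp: C_def)
  have e': "e / (2 * C) > 0" using e C by simp
  obtain r where r: "r > 0" and R: "\<And>(n::nat) (u :: nat \<Rightarrow> real) v.
        (\<forall>i<n. a \<le> u i \<and> u i \<le> v i \<and> v i \<le> b) \<and>
        disjoint_family_on (\<lambda>i. {u i<..<v i}) {..<n} \<and>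
        (\<Sum>i<n. v i - u i) < r \<Longrightarrow> (\<Sum>i<n. \<bar>f (v i) - f (u i)\<bar>) < e / (2 * C)"
    using assms(1) e' unfolding abs_continuous_def by meson
  obtain s where s: "s > 0" and S: "\<And>(n::nat) (u :: nat \<Rightarrow> real) v.
        (\<forall>i<n. a \<le> u i \<and> u i \<le> v i \<and> v i \<le> b) \<and>
        disjoint_family_on (\<lambda>i. {u i<..<v i}) {..<n} \<and>
        (\<Sum>i<n. v i - u i) < s \<Longrightarrow> (\<Sum>i<n. \<bar>g (v i) - g (u i)\<bar>) < e / (2 * C)"
    using assms(2) e' unfolding abs_continuous_def by meson
  show "\<exists>r>0. \<forall>n (u :: nat \<Rightarrow> real) v.
        (\<forall>i<n. a \<le> u i \<and> u i \<le> v i \<and> v i \<le> b) \<and>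
        disjoint_family_on (\<lambda>i. {u i<..<v i}) {..<n} \<and>
        (\<Sum>i<n. v i - u i) < r \<longrightarrow> (\<Sum>i<n. \<bar>f (v i) * g (v i) - f (u i) * g (u i)\<bar>) < e"
  proof (intro exI[of _ "min r s"] conjI allI impI)
    show "min r s > 0" using r s by simp
    fix n :: nat and u v :: "nat \<Rightarrow> real"
    assume H: "(\<forall>i<n. a \<le> u i \<and> u i \<le> v i \<and> v i \<le> b) \<and>
        disjoint_family_on (\<lambda>i. {u i<..<v i}) {..<n} \<and> (\<Sum>i<n. v i - u i) < min r s"
    have "(\<Sum>i<n. \<bar>f (v i) * g (v i) - f (u i) * g (u i)\<bar>)
        \<le> (\<Sum>i<n. C * \<bar>f (v i) - f (u i)\<bar> + C * \<bar>g (v i) - g (u i)\<bar>)"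
    proof (rule sum_mono)
      fix i assume "i \<in> {..<n}"
      then have uv: "u i \<in> {a..b}" "v i \<in> {a..b}" using H by force+
      have "f (v i) * g (v i) - f (u i) * g (u i)
        = g (v i) * (f (v i) - f (u i)) + f (u i) * (g (v i) - g (u i))" by (simp add: algebra_simps)
      also have "\<bar>\<dots>\<bar> \<le> \<bar>g (v i)\<bar> * \<bar>f (v i) - f (u i)\<bar> + \<bar>f (u i)\<bar> * \<bar>g (v i) - g (u i)\<bar>"
        by (metis abs_mult abs_triangle_ineq)
      also have "\<dots> \<le> C * \<bar>f (v i) - f (u i)\<bar> + C * \<bar>g (v i) - g (u i)\<bar>"
        using A[OF uv(1)] B[OF uv(2)] C by (intro add_mono mult_right_mono) auto
      finally show "\<bar>f (v i) * g (v i) - f (u i) * g (u i)\<bar>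
        \<le> C * \<bar>f (v i) - f (u i)\<bar> + C * \<bar>g (v i) - g (u i)\<bar>" .
    qed
    also have "\<dots> = C * (\<Sum>i<n. \<bar>f (v i) - f (u i)\<bar>) + C * (\<Sum>i<n. \<bar>g (v i) - g (u i)\<bar>)"
      by (simp add: sum.distrib sum_distrib_left)
    also have "\<dots> < C * (e / (2 * C)) + C * (e / (2 * C))"
      using R[of n u v] S[of n u v] H C by (intro add_strict_mono mult_strict_left_mono) auto
    also have "\<dots> = e" using C by simp
    finally show "(\<Sum>i<n. \<bar>f (v i) * g (v i) - f (u i) * g (u i)\<bar>) < e" .
  qed
qed

section \<open>Variation on short intervals and the local Jordan decomposition\<close>

definition interval_family :: "real \<Rightarrow> real \<Rightarrow> nat \<Rightarrow> (nat \<Rightarrow> real) \<Rightarrow> (nat \<Rightarrow> real) \<Rightarrow> bool" where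
  "interval_family c d n u v \<longleftrightarrow> (\<forall>i<n. c \<le> u i \<and> u i \<le> v i \<and> v i \<le> d) \<and>
     disjoint_family_on (\<lambda>i. {u i<..<v i}) {..<n}"

lemma sum_lengths_le_measure:
  fixes u v :: "'i \<Rightarrow> real"
  assumes "finite I" "\<And>i. i \<in> I \<Longrightarrow> u i \<le> v i" "disjoint_family_on (\<lambda>i. {u i<..<v i}) I"
    and "\<And>i. i \<in> I \<Longrightarrow> {u i<..<v i} \<subseteq> U" "U \<in> lmeasurable"
  shows "(\<Sum>i\<in>I. v i - u i) \<le> measure lebesgue U"
proof -
  have "(\<Sum>i\<in>I. v i - u i) = (\<Sum>i\<in>I. measure lebesgue {u i<..<v i})"
    using assms(2) by (intro sum.cong) auto
  also have "\<dots> = measure lebesgue (\<Union>i\<in>I. {u i<..<v i})"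
    using assms(1,2,3) by (intro measure_finite_Union[symmetric]) auto
  also have "\<dots> \<le> measure lebesgue U"
    using assms(1,4,5) by (intro measure_mono_fmeasurable) auto
  finally show ?thesis .
qed

lemma interval_family_length:
  assumes "interval_family c d n u v" "c \<le> d"
  shows "(\<Sum>i<n. v i - u i) \<le> d - c"
proof -
  have "(\<Sum>i<n. v i - u i) \<le> measure lebesgue {c..d}"
  proof (rule sum_lengths_le_measure)
    show "{u i<..<v i} \<subseteq> {c..d}" if "i \<in> {..<n}" for i
      using assms(1) that by (force simp: interval_family_def)
  qed (use assms(1) in \<open>auto simp: interval_family_def\<close>)
  then show ?thesis using assms(2) by simp
qed

text \<open>On an interval shorter than \<open>r\<close> the length condition of absolute continuity
  holds automatically. This makes the variation finite on short intervals and, applied with small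
  \<open>e\<close>, also continuous.\<close>

lemma abs_continuous_interval_family:
  assumes "abs_continuous a b f" "e > 0"
  obtains r where "r > 0"
    "\<And>c d n u v. a \<le> c \<Longrightarrow> c \<le> d \<Longrightarrow> d \<le> b \<Longrightarrow> d - c < r \<Longrightarrow> interval_family c d n u v
       \<Longrightarrow> (\<Sum>i<n. \<bar>f (v i) - f (u i)\<bar>) < e"
proof -
  obtain r where r: "r > 0" and R: "\<And>(n::nat) (u :: nat \<Rightarrow> real) v.
        (\<forall>i<n. a \<le> u i \<and> u i \<le> v i \<and> v i \<le> b) \<and>
        disjoint_family_on (\<lambda>i. {u i<..<v i}) {..<n} \<and>
        (\<Sum>i<n. v i - u i) < r \<Longrightarrow> (\<Sum>i<n. \<bar>f (v i) - f (u i)\<bar>) < e"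
    using assms unfolding abs_continuous_def by meson
  show ?thesis
  proof (rule that[OF r R])
    fix c d n u v assume "a \<le> c" "c \<le> d" "d \<le> b" "d - c < r" and *: "interval_family c d n u v"
    then show "(\<forall>i<n. a \<le> u i \<and> u i \<le> v i \<and> v i \<le> b) \<and>
        disjoint_family_on (\<lambda>i. {u i<..<v i}) {..<n} \<and> (\<Sum>i<n. v i - u i) < r"
      using interval_family_length[OF *] by (force simp: interval_family_def)
  qed
qed

text \<open>Disjoint families replace partitions because these are the sums that
  \<open>abs_continuous\<close> controls. Degenerate intervals are allowed, so a family remains one
  after truncation at a point.\<close>

definition variation_sums :: "(real \<Rightarrow> real) \<Rightarrow> real \<Rightarrow> real \<Rightarrow> real set" where
  "variation_sums f c d = {\<Sum>i<n. \<bar>f (v i) - f (u i)\<bar> | n u v. interval_family c d n u v}"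

definition variation :: "(real \<Rightarrow> real) \<Rightarrow> real \<Rightarrow> real \<Rightarrow> real" where
  "variation f c x = Sup (variation_sums f c x)"

lemma variation_sums_nonempty: "variation_sums f c d \<noteq> {}"
  unfolding variation_sums_def
  by (auto simp: interval_family_def disjoint_family_on_def intro!: exI[of _ "0::nat"])

lemma variation_sums_mono: "d \<le> d' \<Longrightarrow> variation_sums f c d \<subseteq> variation_sums f c d'"
  unfolding variation_sums_def interval_family_def by fastforce

lemma variation_sums_append:
  assumes "s \<in> variation_sums f c x" "c \<le> x" "x \<le> y"
  shows "s + \<bar>f y - f x\<bar> \<in> variation_sums f c y"
proof -
  obtain n u v where s: "s = (\<Sum>i<n. \<bar>f (v i) - f (u i)\<bar>)" and F: "interval_family c x n u v"
    using assms(1) by (auto simp: variation_sums_def)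
  define u' v' where "u' = u(n := x)" and "v' = v(n := y)"
  have uv: "i < n \<Longrightarrow> c \<le> u i \<and> u i \<le> v i \<and> v i \<le> x" for i using F by (auto simp: interval_family_def)
  have dj: "i < n \<Longrightarrow> j < n \<Longrightarrow> i \<noteq> j \<Longrightarrow> {u i<..<v i} \<inter> {u j<..<v j} = {}" for i j
    using F by (auto simp: interval_family_def disjoint_family_on_def)
  have dx: "i < n \<Longrightarrow> {u i<..<v i} \<inter> {x<..<y} = {}" for i using uv[of i] by auto
  have "interval_family c y (Suc n) u' v'"
    unfolding interval_family_def disjoint_family_on_def
  proof (intro conjI allI impI ballI)
    fix i assume "i < Suc n"
    then show "c \<le> u' i" "u' i \<le> v' i" "v' i \<le> y"
      using uv[of i] assms(2,3) by (auto simp: u'_def v'_def)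
  next
    fix i j assume "i \<in> {..<Suc n}" "j \<in> {..<Suc n}" "i \<noteq> j"
    then show "{u' i<..<v' i} \<inter> {u' j<..<v' j} = {}"
      using dj[of i j] dx[of i] dx[of j] by (auto simp: u'_def v'_def less_Suc_eq)
  qed
  moreover have "(\<Sum>i<Suc n. \<bar>f (v' i) - f (u' i)\<bar>) = s + \<bar>f y - f x\<bar>"
    by (simp add: u'_def v'_def s)
  ultimately show ?thesis unfolding variation_sums_def by (metis (mono_tags, lifting) mem_Collect_eq)
qed

text \<open>Truncating each interval at \<open>x\<close> splits a family in \<open>[c, y]\<close> into one in \<open>[c, x]\<close> and one in \<open>[x, y]\<close>.\<close>

lemma variation_sums_split:
  assumes "s \<in> variation_sums f c y" "c \<le> x" "x \<le> y"
  obtains s1 s2 where "s1 \<in> variation_sums f c x" "s2 \<in> variation_sums f x y" "s \<le> s1 + s2"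
proof -
  obtain n u v where s: "s = (\<Sum>i<n. \<bar>f (v i) - f (u i)\<bar>)" and F: "interval_family c y n u v"
    using assms(1) by (auto simp: variation_sums_def)
  have uv: "i < n \<Longrightarrow> c \<le> u i \<and> u i \<le> v i \<and> v i \<le> y" for i using F by (auto simp: interval_family_def)
  have dj: "i < n \<Longrightarrow> j < n \<Longrightarrow> i \<noteq> j \<Longrightarrow> {u i<..<v i} \<inter> {u j<..<v j} = {}" for i j
    using F by (auto simp: interval_family_def disjoint_family_on_def)
  have 1: "interval_family c x n (\<lambda>i. min (u i) x) (\<lambda>i. min (v i) x)"
    unfolding interval_family_def disjoint_family_on_def
  proof (intro conjI allI impI ballI)
    fix i assume "i < n"
    then show "c \<le> min (u i) x" "min (u i) x \<le> min (v i) x" "min (v i) x \<le> x"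
      using uv[of i] assms(2) by auto
  next
    fix i j assume "i \<in> {..<n}" "j \<in> {..<n}" "i \<noteq> j"
    then show "{min (u i) x<..<min (v i) x} \<inter> {min (u j) x<..<min (v j) x} = {}"
      using dj[of i j] by (force simp: disjoint_iff)
  qed
  have 2: "interval_family x y n (\<lambda>i. max (u i) x) (\<lambda>i. max (v i) x)"
    unfolding interval_family_def disjoint_family_on_def
  proof (intro conjI allI impI ballI)
    fix i assume "i < n"
    then show "x \<le> max (u i) x" "max (u i) x \<le> max (v i) x" "max (v i) x \<le> y"
      using uv[of i] assms(3) by auto
  next
    fix i j assume "i \<in> {..<n}" "j \<in> {..<n}" "i \<noteq> j"
    then show "{max (u i) x<..<max (v i) x} \<inter> {max (u j) x<..<max (v j) x} = {}"
      using dj[of i j] by (force simp: disjoint_iff)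
  qed
  have "s \<le> (\<Sum>i<n. \<bar>f (min (v i) x) - f (min (u i) x)\<bar> + \<bar>f (max (v i) x) - f (max (u i) x)\<bar>)"
    unfolding s
  proof (rule sum_mono)
    fix i assume "i \<in> {..<n}"
    then have "u i \<le> v i" using uv by auto
    then consider "v i \<le> x" "u i \<le> x" | "u i \<le> x" "x \<le> v i" | "x \<le> u i" "x \<le> v i" by linarith
    then show "\<bar>f (v i) - f (u i)\<bar>
        \<le> \<bar>f (min (v i) x) - f (min (u i) x)\<bar> + \<bar>f (max (v i) x) - f (max (u i) x)\<bar>"
      by cases (simp_all add: min_absorb1 min_absorb2 max_absorb1 max_absorb2)
  qed
  also have "\<dots> = (\<Sum>i<n. \<bar>f (min (v i) x) - f (min (u i) x)\<bar>) + (\<Sum>i<n. \<bar>f (max (v i) x) - f (max (u i) x)\<bar>)"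
    by (rule sum.distrib)
  finally show ?thesis using 1 2 that unfolding variation_sums_def by blast
qed

text \<open>Jordan's decomposition f = V - (V - f) with V the variation from \<open>c\<close>.
  Appending one interval to a family shows that V grows by at least the absolute increment of f,
  which makes both parts monotone.\<close>

lemma abs_continuous_diff_mono:
  assumes f: "abs_continuous c d f" and cd: "c \<le> d"
    and bdd: "\<And>n u v. interval_family c d n u v \<Longrightarrow> (\<Sum>i<n. \<bar>f (v i) - f (u i)\<bar>) \<le> B"
  obtains F G where "mono F" "continuous_on UNIV F" "mono G" "continuous_on UNIV G"
    "\<And>x. x \<in> {c..d} \<Longrightarrow> f x = F x - G x"
proof -
  have bd: "bdd_above (variation_sums f c x)" if "x \<le> d" for x
  proof (rule bdd_above_mono)
    show "variation_sums f c x \<subseteq> variation_sums f c d" using that by (rule variation_sums_mono)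
    show "bdd_above (variation_sums f c d)"
      using bdd by (intro bdd_aboveI[of _ B]) (auto simp: variation_sums_def)
  qed
  let ?V = "variation f c"
  have mono: "?V x + \<bar>f y - f x\<bar> \<le> ?V y" if xy: "c \<le> x" "x \<le> y" "y \<le> d" for x y
  proof -
    have "?V x \<le> ?V y - \<bar>f y - f x\<bar>" unfolding variation_def
    proof (intro cSup_least variation_sums_nonempty)
      fix s assume "s \<in> variation_sums f c x"
      then have "s + \<bar>f y - f x\<bar> \<le> Sup (variation_sums f c y)"
        using xy by (intro cSup_upper variation_sums_append bd)
      then show "s \<le> Sup (variation_sums f c y) - \<bar>f y - f x\<bar>" by simp
    qed
    then show ?thesis by simp
  qed
  have cont: "continuous_on {c..d} ?V"
    unfolding continuous_on_iff
  proof (intro ballI allI impI)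
    fix x e :: real assume x: "x \<in> {c..d}" and e: "e > 0"
    obtain r where r: "r > 0" "\<And>c' d' n u v. c \<le> c' \<Longrightarrow> c' \<le> d' \<Longrightarrow> d' \<le> d \<Longrightarrow> d' - c' < r
        \<Longrightarrow> interval_family c' d' n u v \<Longrightarrow> (\<Sum>i<n. \<bar>f (v i) - f (u i)\<bar>) < e / 2"
      by (rule abs_continuous_interval_family[OF f half_gt_zero[OF e]]) (rule that)
    \<comment> \<open>A family on \<open>[c, z]\<close> splits at \<open>y\<close>; its part in
      \<open>[y, z]\<close> contributes less than \<open>e / 2\<close> by absolute
      continuity.\<close>
    have small: "?V z \<le> ?V y + e / 2" if yz: "c \<le> y" "y \<le> z" "z \<le> d" "z - y < r" for y z
      unfolding variation_def
    proof (intro cSup_least variation_sums_nonempty)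
      fix s assume "s \<in> variation_sums f c z"
      then obtain s1 s2 where s: "s1 \<in> variation_sums f c y" "s2 \<in> variation_sums f y z" "s \<le> s1 + s2"
        using variation_sums_split[of s f c z y] yz by metis
      have "s2 < e / 2" using s(2) r(2)[of y z] yz by (auto simp: variation_sums_def)
      moreover have "s1 \<le> Sup (variation_sums f c y)" using s(1) yz by (intro cSup_upper bd) auto
      ultimately show "s \<le> Sup (variation_sums f c y) + e / 2" using s(3) by linarith
    qed
    have "dist (?V y) (?V x) < e" if y: "y \<in> {c..d}" "dist y x < r" for y
    proof (cases "x \<le> y")
      case True
      then show ?thesis using small[of x y] mono[of x y] x y e by (auto simp: dist_real_def)
    next
      case False
      then show ?thesis using small[of y x] mono[of y x] x y e by (auto simp: dist_real_def)
    qed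
    then show "\<exists>r>0. \<forall>y\<in>{c..d}. dist y x < r \<longrightarrow> dist (?V y) (?V x) < e" using r(1) by blast
  qed
  \<comment> \<open>Clamping to \<open>[c, d]\<close> extends both parts to monotone continuous
    functions on the whole line, as the differentiability theorem requires.\<close>
  define t where "t x = max c (min d x)" for x
  have t: "continuous_on UNIV t" "range t \<subseteq> {c..d}" "\<And>x. x \<in> {c..d} \<Longrightarrow> t x = x" "\<And>x y. x \<le> y \<Longrightarrow> t x \<le> t y"
    using cd by (auto simp: t_def intro!: continuous_intros)
  have tc: "c \<le> t x" "t x \<le> d" for x using cd by (auto simp: t_def)
  have cf: "continuous_on {c..d} f" using f by (rule abs_continuous_imp_continuous_on)
  show ?thesis
  proof (rule that[of "\<lambda>x. ?V (t x)" "\<lambda>x. ?V (t x) - f (t x)"])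
    have *: "?V (t x) + \<bar>f (t y) - f (t x)\<bar> \<le> ?V (t y)" if "x \<le> y" for x y
      by (rule mono[OF tc(1) t(4)[OF that] tc(2)])
    show "mono (\<lambda>x. ?V (t x))"
    proof (rule monoI)
      fix x y :: real assume "x \<le> y"
      from *[OF this] show "?V (t x) \<le> ?V (t y)" by linarith
    qed
    show "mono (\<lambda>x. ?V (t x) - f (t x))"
    proof (rule monoI)
      fix x y :: real assume "x \<le> y"
      from *[OF this] show "?V (t x) - f (t x) \<le> ?V (t y) - f (t y)" by linarith
    qed
    show "continuous_on UNIV (\<lambda>x. ?V (t x))"
      using cont t by (intro continuous_on_compose2[OF cont t(1)]) auto
    show "continuous_on UNIV (\<lambda>x. ?V (t x) - f (t x))"
      by (intro continuous_on_diff continuous_on_compose2[OF cont t(1)] continuous_on_compose2[OF cf t(1)] t(2))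
  qed (simp add: t(3))
qed

text \<open>The variation bound is available only on intervals shorter than \<open>r\<close>, so the
  argument is local: a set is negligible once each of its points has a relatively open neighbourhood
  in it that is negligible.\<close>

theorem abs_continuous_differentiable_ae:
  assumes f: "abs_continuous a b f"
  shows "negligible {x \<in> {a..b}. \<nexists>D. (f has_real_derivative D) (at x)}"
proof -
  let ?S = "{x \<in> {a<..<b}. \<nexists>D. (f has_real_derivative D) (at x)}"
  obtain r where r: "r > 0" "\<And>c d n u v. a \<le> c \<Longrightarrow> c \<le> d \<Longrightarrow> d \<le> b \<Longrightarrow> d - c < r \<Longrightarrow> interval_family c d n u v
       \<Longrightarrow> (\<Sum>i<n. \<bar>f (v i) - f (u i)\<bar>) < 1"
    by (rule abs_continuous_interval_family[OF f zero_less_one]) (rule that)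
  have "negligible ?S"
  proof (subst locally_negligible_alt, intro ballI)
    fix x assume xS: "x \<in> ?S"
    then have x: "a < x" "x < b" by simp_all
    \<comment> \<open>Reaching at most \<open>r / 3\<close> to either side keeps the length below
      \<open>r\<close>; the caps at \<open>a\<close> and \<open>b\<close> keep the interval inside
      \<open>[a, b]\<close>.\<close>
    define c d where "c = max a (x - r / 3)" and "d = min b (x + r / 3)"
    have cd: "a \<le> c" "c < x" "x < d" "d \<le> b" "d - c < r"
      using x r(1) unfolding c_def d_def by auto
    obtain F G where FG: "mono F" "continuous_on UNIV F" "mono G" "continuous_on UNIV G"
      "\<And>x. x \<in> {c..d} \<Longrightarrow> f x = F x - G x"
    proof (rule abs_continuous_diff_mono)
      show "abs_continuous c d f" using f cd(1,4) by (rule abs_continuous_subinterval)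
      show "c \<le> d" using cd by simp
      show "(\<Sum>i<n. \<bar>f (v i) - f (u i)\<bar>) \<le> 1" if "interval_family c d n u v" for n u v
        using r(2)[of c d n u v] that cd by simp
    qed (rule that)
    let ?N = "{x \<in> {c<..<d}. \<nexists>D. (F has_real_derivative D) (at x)} \<union> {x \<in> {c<..<d}. \<nexists>D. (G has_real_derivative D) (at x)}"
    have "?S \<inter> {c<..<d} \<subseteq> ?N"
    proof
      fix y assume y: "y \<in> ?S \<inter> {c<..<d}"
      show "y \<in> ?N"
      proof (rule ccontr)
        assume "y \<notin> ?N"
        then obtain D E where "(F has_real_derivative D) (at y)" "(G has_real_derivative E) (at y)"
          using y by blast
        then have "((\<lambda>x. F x - G x) has_real_derivative D - E) (at y)" by (rule DERIV_diff)
        then have "(f has_real_derivative D - E) (at y)"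
          by (rule has_field_derivative_transform_within_open[of _ _ _ "{c<..<d}"]) (use y FG(5) in auto)
        then show False using y by blast
      qed
    qed
    moreover have "negligible ?N"
      using FG by (intro negligible_Un mono_continuous_differentiable_ae)
    ultimately have "negligible (?S \<inter> {c<..<d})" by (rule negligible_subset[rotated])
    moreover have "openin (top_of_set ?S) (?S \<inter> {c<..<d})" by (intro openin_open_Int) simp
    ultimately show "\<exists>U. openin (top_of_set ?S) U \<and> x \<in> U \<and> negligible U"
      using xS cd by (intro exI[of _ "?S \<inter> {c<..<d}"]) simp
  qed
  then have "negligible (?S \<union> {a, b})" by (intro negligible_Un) auto
  then show ?thesis by (rule negligible_subset) force
qed

section \<open>The fundamental theorem of calculus and absolute integrability of the
  derivative\<close>

lemma abs_continuous_finite_family: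
  assumes "abs_continuous a b f" "e > 0"
  obtains r where "r > 0"
    "\<And>(I :: 'i set) u v. finite I \<Longrightarrow> (\<forall>i\<in>I. a \<le> u i \<and> u i \<le> v i \<and> v i \<le> b)
       \<Longrightarrow> disjoint_family_on (\<lambda>i. {u i<..<v i}) I \<Longrightarrow> (\<Sum>i\<in>I. v i - u i) < r
       \<Longrightarrow> (\<Sum>i\<in>I. \<bar>f (v i) - f (u i)\<bar>) < e"
proof -
  obtain r where r: "r > 0" and R: "\<And>(n::nat) (u :: nat \<Rightarrow> real) v.
        (\<forall>i<n. a \<le> u i \<and> u i \<le> v i \<and> v i \<le> b) \<and>
        disjoint_family_on (\<lambda>i. {u i<..<v i}) {..<n} \<and>
        (\<Sum>i<n. v i - u i) < r \<Longrightarrow> (\<Sum>i<n. \<bar>f (v i) - f (u i)\<bar>) < e"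
    using assms unfolding abs_continuous_def by meson
  show ?thesis
  proof (rule that[OF r])
    fix I :: "'i set" and u v
    assume I: "finite I" "\<forall>i\<in>I. a \<le> u i \<and> u i \<le> v i \<and> v i \<le> b"
      "disjoint_family_on (\<lambda>i. {u i<..<v i}) I" "(\<Sum>i\<in>I. v i - u i) < r"
    obtain h where h: "bij_betw h {..<card I} I"
      using ex_bij_betw_nat_finite[OF I(1)] by (auto simp: atLeast0LessThan)
    have hI: "h i \<in> I" if "i < card I" for i using bij_betwE[OF h] that by blast
    have "disjoint_family_on (\<lambda>i. {u (h i)<..<v (h i)}) {..<card I}"
      unfolding disjoint_family_on_def
    proof (intro ballI impI)
      fix i j assume ij: "i \<in> {..<card I}" "j \<in> {..<card I}" "i \<noteq> j"
      then have "h i \<noteq> h j" using bij_betw_imp_inj_on[OF h] by (auto dest: inj_onD)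
      then show "{u (h i)<..<v (h i)} \<inter> {u (h j)<..<v (h j)} = {}"
        using I(3) hI ij by (auto simp: disjoint_family_on_def)
    qed
    moreover have "(\<Sum>i<card I. v (h i) - u (h i)) = (\<Sum>i\<in>I. v i - u i)"
      using h by (rule sum.reindex_bij_betw)
    ultimately have "(\<Sum>i<card I. \<bar>f (v (h i)) - f (u (h i))\<bar>) < e"
      using I(2,4) hI by (intro R) simp
    moreover have "(\<Sum>i<card I. \<bar>f (v (h i)) - f (u (h i))\<bar>) = (\<Sum>i\<in>I. \<bar>f (v i) - f (u i)\<bar>)"
      using h by (rule sum.reindex_bij_betw)
    ultimately show "(\<Sum>i\<in>I. \<bar>f (v i) - f (u i)\<bar>) < e" by simp
  qed
qed

lemma negligible_open_cover:
  fixes N :: "real set"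
  assumes "negligible N" "r > 0"
  obtains U where "open U" "N \<subseteq> U" "U \<in> lmeasurable" "measure lebesgue U < r"
proof -
  have N: "N \<in> lmeasurable" "measure lebesgue N = 0"
    using assms(1) by (auto simp: negligible_iff_measure)
  obtain U where U: "open U" "N \<subseteq> U" "U - N \<in> lmeasurable" "emeasure lebesgue (U - N) < ennreal r"
    using sets_lebesgue_outer_open[of N r] N(1) assms(2) by (auto simp: fmeasurableD)
  have eq: "U = N \<union> (U - N)" using U by auto
  have Um: "U \<in> lmeasurable" using N(1) U(3) by (subst eq) (rule fmeasurable.Un)
  have "measure lebesgue (U - N) < r"
    using U(3,4) assms(2) by (simp add: emeasure_eq_measure2 ennreal_less_iff)
  then have "measure lebesgue U < r"
    using measure_Un_le[of N lebesgue "U - N"] N U(3) eq by (simp add: fmeasurableD)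
  then show ?thesis using that U Um by blast
qed

text \<open>In the gauge integral the exceptional null set N can be treated directly. At tags
  outside N the derivative approximates the increment up to \<eta> times the length. At tags in N
  the integrand is set to 0 and the gauge confines the intervals to an open set of measure below
  \<open>r\<close>, where absolute continuity makes the sum of the increments small.\<close>

theorem abs_continuous_has_integral_deriv:
  assumes ab: "a \<le> b" and f: "abs_continuous a b f"
  shows "(deriv f has_integral f b - f a) {a..b}"
proof -
  define N where "N = {x \<in> {a..b}. \<nexists>D. (f has_real_derivative D) (at x)}"
  have N: "negligible N" unfolding N_def using f by (rule abs_continuous_differentiable_ae)
  define \<phi> where "\<phi> x = (if x \<in> N then 0 else deriv f x)" for x
  have der: "(f has_real_derivative \<phi> x) (at x)" if x: "x \<in> {a..b}" "x \<notin> N" for x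
  proof -
    obtain D where "(f has_real_derivative D) (at x)" using x unfolding N_def by blast
    then show ?thesis using x(2) DERIV_imp_deriv[of f D x] by (simp add: \<phi>_def)
  qed
  have "(\<phi> has_integral f b - f a) (cbox a b)"
    unfolding has_integral
  proof (intro allI impI)
    fix e :: real assume e: "e > 0"
    \<comment> \<open>The outside error sums to at most \<open>\<eta> * (b - a) \<le> e / 2\<close>;
      the summand 1 guards against \<open>a = b\<close>.\<close>
    define \<eta> where "\<eta> = e / (2 * (b - a + 1))"
    have \<eta>: "\<eta> > 0" "\<eta> * (b - a) \<le> e / 2"
      using e ab by (auto simp: \<eta>_def field_simps)
    have "\<exists>d>0. x \<in> {a..b} \<and> x \<notin> N \<longrightarrow>
        (\<forall>y. \<bar>y - x\<bar> < d \<longrightarrow> \<bar>f y - f x - \<phi> x * (y - x)\<bar> \<le> \<eta> * \<bar>y - x\<bar>)" for x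
    proof (cases "x \<in> {a..b} \<and> x \<notin> N")
      case True
      then have "(f has_derivative (*) (\<phi> x)) (at x)" using der by (simp add: has_field_derivative_def)
      then show ?thesis using \<eta>(1) True unfolding has_derivative_at_alt by auto
    qed (auto intro: exI[of _ 1])
    then obtain d where d: "\<And>x. d x > 0" "\<And>x y. x \<in> {a..b} \<Longrightarrow> x \<notin> N \<Longrightarrow> \<bar>y - x\<bar> < d x
        \<Longrightarrow> \<bar>f y - f x - \<phi> x * (y - x)\<bar> \<le> \<eta> * \<bar>y - x\<bar>"
      by metis
    obtain r where r: "r > 0" and R: "\<And>(I :: (real \<times> real set) set) u v. finite I
       \<Longrightarrow> (\<forall>i\<in>I. a \<le> u i \<and> u i \<le> v i \<and> v i \<le> b)
       \<Longrightarrow> disjoint_family_on (\<lambda>i. {u i<..<v i}) I \<Longrightarrow> (\<Sum>i\<in>I. v i - u i) < r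
       \<Longrightarrow> (\<Sum>i\<in>I. \<bar>f (v i) - f (u i)\<bar>) < e / 2"
      by (rule abs_continuous_finite_family[OF f half_gt_zero[OF e]]) (rule that)
    obtain U where U: "open U" "N \<subseteq> U" "U \<in> lmeasurable" "measure lebesgue U < r"
      using negligible_open_cover[OF N r] by blast
    define \<gamma> where "\<gamma> x = (if x \<in> N then U else ball x (d x))" for x
    have \<gamma>: "gauge \<gamma>" unfolding gauge_def \<gamma>_def using U d(1) by auto
    have "norm ((\<Sum>(x, K)\<in>p. measure lborel K *\<^sub>R \<phi> x) - (f b - f a)) < e"
      if p: "p tagged_division_of cbox a b" and fine: "\<gamma> fine p" for p
    proof -
      have fin: "finite p" using p by blast
      define l u :: "real \<times> real set \<Rightarrow> real" where "l = (\<lambda>(x, K). Inf K)" and "u = (\<lambda>(x, K). Sup K)"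
      have K: "snd i = {l i..u i} \<and> l i \<le> u i \<and> a \<le> l i \<and> u i \<le> b \<and> fst i \<in> {l i..u i} \<and> {l i..u i} \<subseteq> \<gamma> (fst i)"
        if i: "i \<in> p" for i
      proof -
        obtain x K where xK: "i = (x, K)" by (cases i)
        then have "x \<in> K" "K \<subseteq> {a..b}" "\<exists>s t. K = cbox s t" "K \<subseteq> \<gamma> x"
          using tagged_division_ofD(2-4)[OF p] i fine by (auto simp: fine_def)
        then obtain s t where "K = {s..t}" "x \<in> {s..t}" "{s..t} \<subseteq> {a..b}" "{s..t} \<subseteq> \<gamma> x" by auto
        then show ?thesis using xK by (auto simp: l_def u_def)
      qed
      have len: "measure lborel (snd i) = u i - l i" if "i \<in> p" for i
        using K[OF that] by (metis measure_lborel_Icc)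
      have disj: "disjoint_family_on (\<lambda>i. {l i<..<u i}) p"
        unfolding disjoint_family_on_def
      proof (intro ballI impI)
        fix i j assume ij: "i \<in> p" "j \<in> p" "i \<noteq> j"
        then have "interior (snd i) \<inter> interior (snd j) = {}"
          using tagged_division_ofD(5)[OF p, of "fst i" "snd i" "fst j" "snd j"] by simp
        then show "{l i<..<u i} \<inter> {l j<..<u j} = {}"
          using K[OF ij(1)] K[OF ij(2)] by simp
      qed
      have "(\<Sum>(x, K)\<in>p. measure lborel K *\<^sub>R \<phi> x) - (f b - f a)
          = (\<Sum>(x, K)\<in>p. measure lborel K *\<^sub>R \<phi> x) - (\<Sum>(x, K)\<in>p. f (Sup K) - f (Inf K))"
        using additive_tagged_division_1[of a b p f] ab p by simp
      also have "\<dots> = (\<Sum>i\<in>p. (u i - l i) * \<phi> (fst i) - (f (u i) - f (l i)))"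
        unfolding sum_subtractf[symmetric]
        using len by (intro sum.cong) (auto simp: l_def u_def split_beta)
      finally have eq: "(\<Sum>(x, K)\<in>p. measure lborel K *\<^sub>R \<phi> x) - (f b - f a)
          = (\<Sum>i\<in>p. (u i - l i) * \<phi> (fst i) - (f (u i) - f (l i)))" .
      define q where "q = {i \<in> p. fst i \<in> N}"
      have qp: "q \<subseteq> p" by (auto simp: q_def)
      have "\<bar>\<Sum>i\<in>p. (u i - l i) * \<phi> (fst i) - (f (u i) - f (l i))\<bar>
          \<le> (\<Sum>i\<in>p. \<bar>(u i - l i) * \<phi> (fst i) - (f (u i) - f (l i))\<bar>)" by (rule sum_abs)
      also have "\<dots> = (\<Sum>i\<in>q. \<bar>(u i - l i) * \<phi> (fst i) - (f (u i) - f (l i))\<bar>)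
          + (\<Sum>i\<in>p - q. \<bar>(u i - l i) * \<phi> (fst i) - (f (u i) - f (l i))\<bar>)"
        using sum.subset_diff[OF qp fin] by (simp add: add.commute)
      also have "(\<Sum>i\<in>q. \<bar>(u i - l i) * \<phi> (fst i) - (f (u i) - f (l i))\<bar>) = (\<Sum>i\<in>q. \<bar>f (u i) - f (l i)\<bar>)"
        by (intro sum.cong) (auto simp: q_def \<phi>_def)
      also have "\<dots> < e / 2"
      proof (rule R)
        show "finite q" using fin qp by (rule finite_subset[rotated])
        show disj_q: "disjoint_family_on (\<lambda>i. {l i<..<u i}) q"
          using qp disj by (rule disjoint_family_on_mono)
        have "(\<Sum>i\<in>q. u i - l i) \<le> measure lebesgue U"
        proof (rule sum_lengths_le_measure[OF \<open>finite q\<close> _ disj_q _ U(3)])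
          fix i assume i: "i \<in> q"
          then have ip: "i \<in> p" using qp by blast
          show "l i \<le> u i" using K[OF ip] by simp
          have "{l i..u i} \<subseteq> U" using K[OF ip] i by (simp add: q_def \<gamma>_def)
          then show "{l i<..<u i} \<subseteq> U" by force
        qed
        then show "(\<Sum>i\<in>q. u i - l i) < r" using U(4) by simp
      qed (use K qp in blast)
      also have "(\<Sum>i\<in>p - q. \<bar>(u i - l i) * \<phi> (fst i) - (f (u i) - f (l i))\<bar>) \<le> (\<Sum>i\<in>p - q. \<eta> * (u i - l i))"
      proof (rule sum_mono)
        fix i assume i: "i \<in> p - q"
        define x where "x = fst i"
        have ip: "i \<in> p" and xN: "x \<notin> N" using i by (auto simp: q_def x_def)
        have x: "x \<in> {l i..u i}" "x \<in> {a..b}" using K[OF ip] by (auto simp: x_def)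
        have sub: "{l i..u i} \<subseteq> ball x (d x)" using K[OF ip] xN by (simp add: \<gamma>_def x_def)
        have "l i \<in> ball x (d x)" "u i \<in> ball x (d x)"
          by (rule subsetD[OF sub], use x(1) in simp)+
        then have "\<bar>l i - x\<bar> < d x" "\<bar>u i - x\<bar> < d x" by (auto simp: dist_real_def)
        from d(2)[OF x(2) xN this(1)] d(2)[OF x(2) xN this(2)]
        have "\<bar>f (l i) - f x - \<phi> x * (l i - x)\<bar> \<le> \<eta> * (x - l i)" "\<bar>f (u i) - f x - \<phi> x * (u i - x)\<bar> \<le> \<eta> * (u i - x)"
          using x(1) by auto
        \<comment> \<open>The tag lies between the end points, so the two linearization errors are
          bounded by \<eta> times the two parts of the interval, and these parts add up to its
          length.\<close>
        moreover have "(u i - l i) * \<phi> x - (f (u i) - f (l i))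
            = (f (l i) - f x - \<phi> x * (l i - x)) - (f (u i) - f x - \<phi> x * (u i - x))"
          by (simp add: algebra_simps)
        ultimately have "\<bar>(u i - l i) * \<phi> x - (f (u i) - f (l i))\<bar> \<le> \<eta> * (x - l i) + \<eta> * (u i - x)" by linarith
        then show "\<bar>(u i - l i) * \<phi> (fst i) - (f (u i) - f (l i))\<bar> \<le> \<eta> * (u i - l i)"
          by (simp add: x_def algebra_simps)
      qed
      also have "\<dots> \<le> (\<Sum>i\<in>p. \<eta> * (u i - l i))"
        using fin \<eta>(1) K by (intro sum_mono2) auto
      also have "\<dots> = \<eta> * (\<Sum>i\<in>p. u i - l i)" by (simp add: sum_distrib_left)
      also have "(\<Sum>i\<in>p. u i - l i) = b - a"
        using additive_tagged_division_1[of a b p "\<lambda>x. x"] ab p by (simp add: l_def u_def split_beta)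
      also have "\<eta> * (b - a) \<le> e / 2" by (rule \<eta>(2))
      finally show ?thesis unfolding eq real_norm_def by simp
    qed
    then show "\<exists>\<gamma>. gauge \<gamma> \<and> (\<forall>p. p tagged_division_of cbox a b \<and> \<gamma> fine p \<longrightarrow>
        norm ((\<Sum>(x, K)\<in>p. measure lborel K *\<^sub>R \<phi> x) - (f b - f a)) < e)"
      using \<gamma> by blast
  qed
  then have "(deriv f has_integral f b - f a) (cbox a b)"
    by (rule has_integral_spike[OF N, rotated]) (simp add: \<phi>_def)
  then show ?thesis by simp
qed

text \<open>Gauge integrability alone is conditional. It becomes absolute once the indefinite
  integral has bounded variation, and by the fundamental theorem that indefinite integral is
  \<open>f\<close> up to a constant.\<close>

lemma abs_continuous_absolutely_integrable_short:
  assumes ab: "a \<le> b" and f: "abs_continuous a b f"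
    and bdd: "\<And>(D :: real set set) u v. finite D \<Longrightarrow> (\<And>i. i \<in> D \<Longrightarrow> a \<le> u i \<and> u i \<le> v i \<and> v i \<le> b)
       \<Longrightarrow> disjoint_family_on (\<lambda>i. {u i<..<v i}) D \<Longrightarrow> (\<Sum>i\<in>D. \<bar>f (v i) - f (u i)\<bar>) \<le> B"
  shows "deriv f absolutely_integrable_on {a..b}"
proof -
  have "deriv f absolutely_integrable_on cbox a b"
  proof (rule bounded_variation_absolutely_integrable_interval)
    show "deriv f integrable_on cbox a b"
      using abs_continuous_has_integral_deriv[OF ab f] by auto
    fix D assume D: "D division_of cbox a b"
    have K: "K = {Inf K..Sup K} \<and> Inf K \<le> Sup K \<and> a \<le> Inf K \<and> Sup K \<le> b" if K: "K \<in> D" for K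
    proof -
      obtain s t where "K = {s..t}" "K \<noteq> {}" "K \<subseteq> {a..b}"
        using division_ofD(2-4)[OF D K] by auto
      then show ?thesis by auto
    qed
    have "(\<Sum>K\<in>D. norm (integral K (deriv f))) = (\<Sum>K\<in>D. \<bar>f (Sup K) - f (Inf K)\<bar>)"
    proof (rule sum.cong[OF refl])
      fix Q assume "Q \<in> D"
      note Q = K[OF this]
      have "(deriv f has_integral f (Sup Q) - f (Inf Q)) {Inf Q..Sup Q}"
        using Q by (intro abs_continuous_has_integral_deriv) (auto intro: abs_continuous_subinterval[OF f])
      then have "(deriv f has_integral f (Sup Q) - f (Inf Q)) Q" using Q by simp
      then have "integral Q (deriv f) = f (Sup Q) - f (Inf Q)" by (rule integral_unique)
      then show "norm (integral Q (deriv f)) = \<bar>f (Sup Q) - f (Inf Q)\<bar>" by simp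
    qed
    also have "\<dots> \<le> B"
    proof (rule bdd)
      show "finite D" using D by blast
      show "disjoint_family_on (\<lambda>K. {Inf K<..<Sup K}) D"
        unfolding disjoint_family_on_def
      proof (intro ballI impI)
        fix i j assume ij: "i \<in> D" "j \<in> D" "i \<noteq> j"
        have "interior i = {Inf i<..<Sup i}" "interior j = {Inf j<..<Sup j}"
          using K[OF ij(1)] K[OF ij(2)] by (metis interior_atLeastAtMost_real)+
        then show "{Inf i<..<Sup i} \<inter> {Inf j<..<Sup j} = {}"
          using division_ofD(5)[OF D ij] by simp
      qed
    qed (use K in blast)
    finally show "(\<Sum>K\<in>D. norm (integral K (deriv f))) \<le> B" .
  qed
  then show ?thesis by simp
qed

text \<open>Absolute continuity with tolerance 1 bounds the variation on pieces shorter than some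
  \<open>r\<close>; finitely many such pieces cover \<open>[a, b]\<close>, and absolute
  integrability passes to their union.\<close>

theorem abs_continuous_absolutely_integrable_deriv:
  assumes f: "abs_continuous a b f"
  shows "deriv f absolutely_integrable_on {a..b}"
proof -
  obtain r where r: "r > 0" and R: "\<And>(I :: real set set) u v. finite I
       \<Longrightarrow> (\<forall>i\<in>I. a \<le> u i \<and> u i \<le> v i \<and> v i \<le> b)
       \<Longrightarrow> disjoint_family_on (\<lambda>i. {u i<..<v i}) I \<Longrightarrow> (\<Sum>i\<in>I. v i - u i) < r
       \<Longrightarrow> (\<Sum>i\<in>I. \<bar>f (v i) - f (u i)\<bar>) < 1"
    by (rule abs_continuous_finite_family[OF f zero_less_one]) (rule that)
  have short: "deriv f absolutely_integrable_on {c..d}" if cd: "a \<le> c" "c \<le> d" "d \<le> b" "d - c < r" for c d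
  proof (rule abs_continuous_absolutely_integrable_short)
    show "c \<le> d" by fact
    show "abs_continuous c d f" using f cd(1,3) by (rule abs_continuous_subinterval)
    fix D :: "real set set" and u v
    assume D: "finite D" "\<And>i. i \<in> D \<Longrightarrow> c \<le> u i \<and> u i \<le> v i \<and> v i \<le> d"
       "disjoint_family_on (\<lambda>i. {u i<..<v i}) D"
    have "(\<Sum>i\<in>D. v i - u i) \<le> measure lebesgue {c..d}"
      using D by (intro sum_lengths_le_measure) force+
    also have "\<dots> < r" using cd by simp
    finally have "(\<Sum>i\<in>D. \<bar>f (v i) - f (u i)\<bar>) < 1"
      using D cd by (intro R) force+
    then show "(\<Sum>i\<in>D. \<bar>f (v i) - f (u i)\<bar>) \<le> 1" by simp
  qed
  \<comment> \<open>Pieces of length at most \<open>r / 2\<close> are strictly shorter than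
    \<open>r\<close>; the cap at \<open>b\<close> makes the induction reach exactly
    \<open>[a, b]\<close>.\<close>
  have "deriv f absolutely_integrable_on {a..min b (a + real n * (r / 2))}" for n
  proof (induction n)
    case 0
    show ?case by (rule absolutely_integrable_negligible) (cases "a \<le> b"; auto simp: min_def)
  next
    case (Suc n)
    let ?c = "min b (a + real n * (r / 2))" and ?d = "min b (a + real (Suc n) * (r / 2))"
    show ?case
    proof (cases "a \<le> b")
      case True
      have c: "a \<le> ?c" "?c \<le> ?d" "?d \<le> b" "?d - ?c < r"
        using r True by (auto simp: min_def field_simps)
      then have "deriv f absolutely_integrable_on ({a..?c} \<union> {?c..?d})"
        by (intro absolutely_integrable_Un Suc.IH short)
      also have "{a..?c} \<union> {?c..?d} = {a..?d}" using c by (intro ivl_disj_un_two_touch) auto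
      finally show ?thesis .
    qed (simp add: absolutely_integrable_negligible)
  qed
  moreover obtain n where "(b - a) / (r / 2) \<le> real n" using real_arch_simple by blast
  then have "min b (a + real n * (r / 2)) = b" using r by (auto simp: min_def field_simps)
  ultimately show ?thesis by metis
qed

section \<open>Reduction to a Sturm-Liouville problem\<close>

lemma integrable_lebesgue_on_iff:
  fixes f :: "real \<Rightarrow> real"
  shows "integrable (lebesgue_on {a..b}) f \<longleftrightarrow> f absolutely_integrable_on {a..b}"
  by (simp add: set_integrable_def integrable_restrict_space)

lemma integrable_deriv:
  assumes "abs_continuous a b f"
  shows "integrable (lebesgue_on {a..b}) (deriv f)"
  unfolding integrable_lebesgue_on_iff using assms by (rule abs_continuous_absolutely_integrable_deriv)

lemma integrable_continuous_mult:
  fixes c :: "real \<Rightarrow> real"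
  assumes c: "continuous_on {a..b} c" and f: "integrable (lebesgue_on {a..b}) f"
  shows "integrable (lebesgue_on {a..b}) (\<lambda>t. c t * f t)"
  unfolding integrable_lebesgue_on_iff
proof (rule absolutely_integrable_bounded_measurable_product_real)
  show "c \<in> borel_measurable (lebesgue_on {a..b})"
    using c by (rule continuous_imp_measurable_on_sets_lebesgue) simp
  show "bounded (c ` {a..b})"
    using c by (intro compact_imp_bounded compact_continuous_image) auto
  show "f absolutely_integrable_on {a..b}" using f by (simp add: integrable_lebesgue_on_iff)
qed simp

lemma integrable_continuous_lebesgue_on:
  fixes c :: "real \<Rightarrow> real"
  assumes "continuous_on {a..b} c"
  shows "integrable (lebesgue_on {a..b}) c"
  unfolding integrable_lebesgue_on_iff using assms by (rule absolutely_integrable_continuous_real)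

lemma AE_lebesgue_on_negligible:
  fixes S :: "real set"
  assumes "negligible N" "S \<in> sets lebesgue" "\<And>x. x \<in> S \<Longrightarrow> x \<notin> N \<Longrightarrow> P x"
  shows "AE x in lebesgue_on S. P x"
proof -
  have "AE x in lebesgue. x \<notin> N" using assms(1) by (intro AE_not_in) (simp add: negligible_iff_null_sets)
  then have "AE x in lebesgue. x \<in> S \<longrightarrow> P x" using assms(3) by (auto elim: eventually_mono)
  then show ?thesis using assms(2) by (subst AE_restrict_space_iff) auto
qed

lemma AE_lebesgue_on_negligibleE:
  fixes S :: "real set"
  assumes "AE x in lebesgue_on S. P x" "S \<in> sets lebesgue"
  obtains N where "negligible N" "\<And>x. x \<in> S \<Longrightarrow> x \<notin> N \<Longrightarrow> P x"
proof -
  have "AE x in lebesgue. x \<in> S \<longrightarrow> P x" using assms by (subst (asm) AE_restrict_space_iff) auto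
  then obtain N where N: "{x \<in> space lebesgue. \<not> (x \<in> S \<longrightarrow> P x)} \<subseteq> N" "emeasure lebesgue N = 0" "N \<in> sets lebesgue"
    by (rule AE_E)
  then have "negligible N" by (simp add: negligible_iff_null_sets null_sets_def)
  moreover have "P x" if "x \<in> S" "x \<notin> N" for x using N(1) that by auto
  ultimately show ?thesis using that by blast
qed

lemma abs_continuous_AE_deriv:
  assumes "abs_continuous a b f"
  shows "AE t in lebesgue_on {a..b}. (f has_real_derivative deriv f t) (at t)"
proof (rule AE_lebesgue_on_negligible)
  show "negligible {x \<in> {a..b}. \<nexists>D. (f has_real_derivative D) (at x)}"
    using assms by (rule abs_continuous_differentiable_ae)
  fix x assume "x \<in> {a..b}" "x \<notin> {x \<in> {a..b}. \<nexists>D. (f has_real_derivative D) (at x)}"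
  then obtain D where "(f has_real_derivative D) (at x)" by blast
  then show "(f has_real_derivative deriv f x) (at x)" using DERIV_imp_deriv by blast
qed simp

lemma integral_deriv:
  assumes "a \<le> b" "abs_continuous a b f"
  shows "(LINT t|lebesgue_on {a..b}. deriv f t) = f b - f a"
proof (rule has_integral_unique)
  show "(deriv f has_integral f b - f a) {a..b}" using assms by (rule abs_continuous_has_integral_deriv)
  show "(deriv f has_integral (LINT t|lebesgue_on {a..b}. deriv f t)) {a..b}"
    using integrable_deriv[OF assms(2)] by (rule has_integral_integral_lebesgue_on) simp
qed

lemma abs_continuous_AE_deriv_mult:
  assumes "abs_continuous a b f" "abs_continuous a b g"
  shows "AE t in lebesgue_on {a..b}. deriv (\<lambda>x. f x * g x) t = deriv f t * g t + f t * deriv g t"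
  using abs_continuous_AE_deriv[OF assms(1)] abs_continuous_AE_deriv[OF assms(2)]
proof eventually_elim
  case (elim t)
  then show ?case by (intro DERIV_imp_deriv) (auto intro!: derivative_eq_intros)
qed

lemma abs_continuous_const: "abs_continuous a b (\<lambda>x. c)"
  by (rule abs_continuous_lipschitz[where K = 0]) simp

lemma integration_by_parts:
  assumes "a \<le> b" "abs_continuous a b f" "abs_continuous a b g" "g a = 0" "g b = 0"
  shows "(LINT t|lebesgue_on {a..b}. deriv f t * g t) = - (LINT t|lebesgue_on {a..b}. f t * deriv g t)"
proof -
  have fg: "abs_continuous a b (\<lambda>x. f x * g x)" using assms by (intro abs_continuous_mult)
  have i1: "integrable (lebesgue_on {a..b}) (\<lambda>t. g t * deriv f t)"
    and i2: "integrable (lebesgue_on {a..b}) (\<lambda>t. f t * deriv g t)"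
    using assms by (auto intro!: integrable_continuous_mult integrable_deriv abs_continuous_imp_continuous_on)
  then have i1': "integrable (lebesgue_on {a..b}) (\<lambda>t. deriv f t * g t)" by (simp add: mult.commute)
  have "0 = (LINT t|lebesgue_on {a..b}. deriv (\<lambda>x. f x * g x) t)"
    using integral_deriv[OF assms(1) fg] assms by simp
  also have "\<dots> = (LINT t|lebesgue_on {a..b}. deriv f t * g t + f t * deriv g t)"
    using integrable_deriv[OF fg] i1' i2 abs_continuous_AE_deriv_mult[OF assms(2,3)]
    by (intro integral_cong_AE) auto
  also have "\<dots> = (LINT t|lebesgue_on {a..b}. deriv f t * g t) + (LINT t|lebesgue_on {a..b}. f t * deriv g t)"
    using i1' i2 by simp
  finally show ?thesis by simp
qed

lemma ito_exp_pos: "ito_exp w t > 0"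
  by (simp add: ito_exp_def)

lemma continuous_on_ito_exp: "continuous_on S w \<Longrightarrow> continuous_on S (ito_exp w)"
  unfolding ito_exp_def by (intro continuous_intros) auto

lemma H1_abs_continuous: "h \<in> H1 a b \<Longrightarrow> abs_continuous a b h"
  by (simp add: H1_def)

text \<open>
  The boundary terms vanish and the two integrals over \<open>E g h'\<close> cancel, so only the derivative of the
  factor \<open>g\<close> survives.
\<close>

lemma weak_L_eq:
  assumes ab: "a < b" and w: "continuous_on {a..b} w"
    and e: "abs_continuous a b e" and g: "ac_factor a b w (deriv e) g" and h: "h \<in> H1 a b"
  shows "weak_L a b w e h = (LINT t|lebesgue_on {a..b}. ito_exp w t * deriv g t * h t) / 2"
proof -
  let ?M = "lebesgue_on {a..b}" and ?E = "ito_exp w"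
  have hac: "abs_continuous a b h" and h0: "h a = 0" "h b = 0" using h by (auto simp: H1_def)
  have gac: "abs_continuous a b g" and ge: "AE t in ?M. deriv e t = ?E t * g t"
    using g by (auto simp: ac_factor_def)
  note cont = continuous_on_ito_exp[OF w] abs_continuous_imp_continuous_on[OF gac] abs_continuous_imp_continuous_on[OF hac]
  have hac2: "abs_continuous a b (\<lambda>t. h t * (1 / 2))"
    using hac by (intro abs_continuous_mult abs_continuous_const)
  have gh: "abs_continuous a b (\<lambda>t. g t * (h t * (1 / 2)))"
    using gac hac2 by (rule abs_continuous_mult)
  have "ac_factor a b w (\<lambda>t. deriv e t * h t / 2) (\<lambda>t. g t * (h t * (1 / 2)))"
    unfolding ac_factor_def using gh ge by (auto elim: eventually_mono)
  from dW_integral_eq[OF ab this]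
  have dW: "dW_integral a b w (\<lambda>t. deriv e t * h t / 2)
      = - (LINT t|?M. ?E t * deriv (\<lambda>t. g t * (h t * (1 / 2))) t)"
    using h0 by simp
  have i1: "integrable ?M (\<lambda>t. (?E t * g t / 2) * deriv h t)"
    using cont hac by (intro integrable_continuous_mult integrable_deriv continuous_intros) auto
  have i2: "integrable ?M (\<lambda>t. (?E t * h t / 2) * deriv g t)"
    using cont gac by (intro integrable_continuous_mult integrable_deriv continuous_intros) auto
  have i3: "integrable ?M (\<lambda>t. ?E t * deriv (\<lambda>t. g t * (h t * (1 / 2))) t)"
    using cont gh by (intro integrable_continuous_mult integrable_deriv) auto
  have "AE t in ?M. ?E t * deriv (\<lambda>t. g t * (h t * (1 / 2))) t
      = (?E t * h t / 2) * deriv g t + (?E t * g t / 2) * deriv h t"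
    using abs_continuous_AE_deriv[OF gac] abs_continuous_AE_deriv[OF hac]
  proof eventually_elim
    case (elim t)
    then have "deriv (\<lambda>t. g t * (h t * (1 / 2))) t = deriv g t * (h t * (1 / 2)) + g t * (deriv h t * (1 / 2))"
      by (intro DERIV_imp_deriv) (auto intro!: derivative_eq_intros)
    then show ?case by (simp add: algebra_simps)
  qed
  then have "(LINT t|?M. ?E t * deriv (\<lambda>t. g t * (h t * (1 / 2))) t)
      = (LINT t|?M. (?E t * h t / 2) * deriv g t + (?E t * g t / 2) * deriv h t)"
    using i1 i2 i3 by (intro integral_cong_AE) auto
  also have "\<dots> = (LINT t|?M. (?E t * h t / 2) * deriv g t) + (LINT t|?M. (?E t * g t / 2) * deriv h t)"
    using i1 i2 by simp
  finally have 1: "(LINT t|?M. ?E t * deriv (\<lambda>t. g t * (h t * (1 / 2))) t)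
      = (LINT t|?M. (?E t * h t / 2) * deriv g t) + (LINT t|?M. (?E t * g t / 2) * deriv h t)" .
  have "(LINT t|?M. deriv e t * deriv h t / 2) = (LINT t|?M. (?E t * g t / 2) * deriv h t)"
  proof (intro integral_cong_AE)
    have [measurable]: "deriv e \<in> borel_measurable ?M" "deriv h \<in> borel_measurable ?M"
      using integrable_deriv[OF e] integrable_deriv[OF hac] by auto
    show "(\<lambda>t. deriv e t * deriv h t / 2) \<in> borel_measurable ?M" by measurable
    show "(\<lambda>t. (?E t * g t / 2) * deriv h t) \<in> borel_measurable ?M" using i1 by auto
    show "AE t in ?M. deriv e t * deriv h t / 2 = (?E t * g t / 2) * deriv h t"
      using ge by eventually_elim simp
  qed
  then have "weak_L a b w e h = (LINT t|?M. (?E t * h t / 2) * deriv g t)"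
    unfolding weak_L_def dW 1 by simp
  also have "\<dots> = (LINT t|?M. (?E t * deriv g t * h t) / 2)"
    by (rule arg_cong[where f = "integral\<^sup>L ?M"]) (auto simp: fun_eq_iff)
  also have "\<dots> = (LINT t|?M. ?E t * deriv g t * h t) / 2" by simp
  finally show ?thesis .
qed

section \<open>Weak eigenfunctions and classical solutions\<close>

lemma deriv_within_Icc:
  fixes f :: "real \<Rightarrow> real"
  assumes "(f has_real_derivative D) (at t within {a..b})" "a < t" "t < b"
  shows "deriv f t = D"
  using assms by (intro DERIV_imp_deriv) (simp add: at_within_Icc_at)

text \<open>The two-sided \<open>deriv\<close> is unrelated to the given one-sided derivatives at
  \<open>a\<close> and \<open>b\<close>, but two points are negligible.\<close>

lemma AE_deriv_within_Icc:
  fixes f :: "real \<Rightarrow> real"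
  assumes "\<And>t. t \<in> {a..b} \<Longrightarrow> (f has_real_derivative f' t) (at t within {a..b})"
  shows "AE t in lebesgue_on {a..b}. deriv f t = f' t"
proof (rule AE_lebesgue_on_negligible)
  show "negligible {a, b}" by auto
  show "deriv f t = f' t" if "t \<in> {a..b}" "t \<notin> {a, b}" for t
    using that by (intro deriv_within_Icc[OF assms]) auto
qed simp

lemma H1_C1:
  fixes h h' :: "real \<Rightarrow> real"
  assumes h: "\<And>t. t \<in> {a..b} \<Longrightarrow> (h has_real_derivative h' t) (at t within {a..b})"
    and h': "continuous_on {a..b} h'" and "h a = 0" "h b = 0"
  shows "h \<in> H1 a b"
proof -
  have ac: "abs_continuous a b h" using h h' by (rule abs_continuous_C1)
  have sq: "integrable (lebesgue_on {a..b}) (\<lambda>t. (c t)\<^sup>2)" if "continuous_on {a..b} c" for c :: "real \<Rightarrow> real"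
    using that by (intro integrable_continuous_lebesgue_on continuous_intros)
  have cont: "continuous_on {a..b} h" using ac by (rule abs_continuous_imp_continuous_on)
  have m: "deriv h \<in> borel_measurable (lebesgue_on {a..b})" using integrable_deriv[OF ac] by auto
  have "AE t in lebesgue_on {a..b}. deriv h t = h' t"
    using h by (rule AE_deriv_within_Icc)
  then have "AE t in lebesgue_on {a..b}. (h' t)\<^sup>2 = (deriv h t)\<^sup>2"
    by eventually_elim simp
  then have "integrable (lebesgue_on {a..b}) (\<lambda>t. (deriv h t)\<^sup>2)"
    using m by (intro integrable_cong_AE_imp[OF sq[OF h']] borel_measurable_power)
  then show ?thesis
    unfolding H1_def L2_def using ac m sq[OF cont] integrable_continuous_lebesgue_on[OF cont] assms(3,4) by auto
qed

text \<open>By the fundamental theorem \<open>f\<close> is the integral of \<open>deriv f\<close>,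
  hence of \<open>c\<close>, and an integral of a continuous function is differentiable everywhere,
  one-sidedly at the end points. This removes the almost-everywhere qualifier.\<close>

lemma abs_continuous_continuous_deriv:
  assumes f: "abs_continuous a b f" and c: "continuous_on {a..b} c"
    and AE: "AE t in lebesgue_on {a..b}. deriv f t = c t" and t: "t \<in> {a..b}"
  shows "(f has_real_derivative c t) (at t within {a..b})"
proof -
  obtain N where N: "negligible N" "\<And>t. t \<in> {a..b} \<Longrightarrow> t \<notin> N \<Longrightarrow> deriv f t = c t"
    using AE by (rule AE_lebesgue_on_negligibleE) auto
  have eq: "f x = f a + integral {a..x} c" if x: "x \<in> {a..b}" for x
  proof -
    have "(deriv f has_integral f x - f a) {a..x}"
      using x by (intro abs_continuous_has_integral_deriv abs_continuous_subinterval[OF f]) auto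
    then have "(c has_integral f x - f a) {a..x}"
      by (rule has_integral_spike[OF N(1), rotated]) (use N(2) x in auto)
    then show ?thesis by (simp add: integral_unique)
  qed
  have "((\<lambda>x. f a + integral {a..x} c) has_real_derivative c t) (at t within {a..b})"
    using integral_has_real_derivative[OF c t] by (auto intro!: derivative_eq_intros)
  then show ?thesis
    by (rule has_field_derivative_transform_within[OF _ zero_less_one t]) (rule eq[symmetric])
qed

text \<open>A first-order system, because \<open>e'\<close> is E times a differentiable function and
  \<open>e''\<close> need not exist when E is only continuous. The equations are required at every
  point, one-sidedly at the ends.\<close>

definition sturm_liouville ::
  "real \<Rightarrow> real \<Rightarrow> (real \<Rightarrow> real) \<Rightarrow> real \<Rightarrow> (real \<Rightarrow> real) \<Rightarrow> (real \<Rightarrow> real) \<Rightarrow> bool" where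
  "sturm_liouville a b E l e g \<longleftrightarrow>
     (\<forall>t\<in>{a..b}. (e has_real_derivative E t * g t) (at t within {a..b})) \<and>
     (\<forall>t\<in>{a..b}. (g has_real_derivative 2 * l * e t / E t) (at t within {a..b})) \<and>
     e a = 0 \<and> e b = 0 \<and> (\<exists>t\<in>{a..b}. e t \<noteq> 0)"

lemma weak_eigenvalueI:
  assumes ab: "a < b" and w: "continuous_on {a..b} w" and sl: "sturm_liouville a b (ito_exp w) l e g"
  shows "l \<in> weak_eigenvalues a b w"
proof -
  let ?M = "lebesgue_on {a..b}" and ?E = "ito_exp w"
  have de: "(e has_real_derivative ?E t * g t) (at t within {a..b})"
    and dg: "(g has_real_derivative 2 * l * e t / ?E t) (at t within {a..b})" if "t \<in> {a..b}" for t
    using sl that by (auto simp: sturm_liouville_def)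
  have AEe: "AE t in ?M. deriv e t = ?E t * g t" using de by (rule AE_deriv_within_Icc)
  have AEg: "AE t in ?M. deriv g t = 2 * l * e t / ?E t" using dg by (rule AE_deriv_within_Icc)
  have "continuous_on {a..b} e" using de by (rule DERIV_continuous_on)
  moreover have "continuous_on {a..b} g" using dg by (rule DERIV_continuous_on)
  moreover have "continuous_on {a..b} ?E" using w by (rule continuous_on_ito_exp)
  ultimately have cont: "continuous_on {a..b} e" "continuous_on {a..b} g" "continuous_on {a..b} ?E" .
  have E0: "?E t \<noteq> 0" for t using ito_exp_pos[of w t] by linarith
  have eH: "e \<in> H1 a b"
    using sl cont by (intro H1_C1[OF de]) (auto simp: sturm_liouville_def intro!: continuous_intros)
  have cdg: "continuous_on {a..b} (\<lambda>t. 2 * l * e t / ?E t)"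
    using cont E0 by (intro continuous_intros) auto
  have gac: "abs_continuous a b g" by (rule abs_continuous_C1[OF dg cdg])
  have fac: "ac_factor a b w (deriv e) g"
    unfolding ac_factor_def using gac AEe by simp
  have "weak_L a b w e h = inner_L2 a b (\<lambda>t. l * e t) h" if h: "h \<in> H1 a b" for h
  proof -
    have hc: "continuous_on {a..b} h" using h by (intro abs_continuous_imp_continuous_on H1_abs_continuous)
    have "(LINT t|?M. ?E t * deriv g t * h t) = (LINT t|?M. 2 * (l * e t * h t))"
    proof (intro integral_cong_AE)
      have "integrable ?M (\<lambda>t. (?E t * h t) * deriv g t)"
        using gac cont hc by (intro integrable_continuous_mult integrable_deriv continuous_intros)
      then show "(\<lambda>t. ?E t * deriv g t * h t) \<in> borel_measurable ?M" by (auto simp: mult_ac)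
      show "(\<lambda>t. 2 * (l * e t * h t)) \<in> borel_measurable ?M"
        using cont hc by (intro borel_measurable_integrable integrable_continuous_lebesgue_on continuous_intros)
      show "AE t in ?M. ?E t * deriv g t * h t = 2 * (l * e t * h t)"
        using AEg
      proof eventually_elim
        case (elim t)
        then show ?case using ito_exp_pos[of w t] by simp
      qed
    qed
    then show ?thesis
      unfolding weak_L_eq[OF ab w H1_abs_continuous[OF eH] fac h] inner_L2_def by simp
  qed
  then show ?thesis
    unfolding weak_eigenvalues_def weak_L_domain_def using eH fac sl by (auto simp: sturm_liouville_def)
qed

text \<open>
  \<open>H1\<close> contains the polynomials that vanish at \<open>a\<close> and \<open>b\<close>, which are uniformly dense by Weierstrass.
\<close>

lemma H1_test_continuous:
  assumes ab: "a < b" and q: "integrable (lebesgue_on {a..b}) q"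
    and H: "\<And>h. h \<in> H1 a b \<Longrightarrow> (LINT t|lebesgue_on {a..b}. q t * h t) = 0"
    and r: "continuous_on {a..b} r" "r a = 0" "r b = 0"
  shows "(LINT t|lebesgue_on {a..b}. q t * r t) = 0"
proof -
  let ?M = "lebesgue_on {a..b}"
  have iq: "integrable ?M (\<lambda>t. q t * c t)" if "continuous_on {a..b} c" for c
    using integrable_continuous_mult[OF that q] by (simp add: mult.commute)
  have bound: "\<bar>LINT t|?M. q t * r t\<bar> \<le> (4 * (LINT t|?M. \<bar>q t\<bar>)) * \<epsilon>" if \<epsilon>: "\<epsilon> > 0" for \<epsilon>
  proof -
    obtain p where p: "real_polynomial_function p" "\<And>x. x \<in> {a..b} \<Longrightarrow> \<bar>r x - p x\<bar> < \<epsilon>"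
      using Stone_Weierstrass_real_polynomial_function[OF _ r(1) \<epsilon>] by auto
    obtain p' where p': "real_polynomial_function p'" "\<And>x. (p has_real_derivative p' x) (at x)"
      using has_real_derivative_polynomial_function[OF p(1)] by auto
    \<comment> \<open>\<open>s\<close> is the slope of the chord of \<open>p\<close>; subtracting
      the chord makes \<open>h\<close> vanish at both ends.\<close>
    define s where "s = (p b - p a) / (b - a)"
    define h where "h t = p t - p a - s * (t - a)" for t
    have pc: "continuous_on {a..b} p'"
      using p'(1) continuous_polymonial_function continuous_at_imp_continuous_on
      by (metis real_polynomial_function_eq)
    have hH: "h \<in> H1 a b"
    proof (rule H1_C1)
      show "(h has_real_derivative p' t - s) (at t within {a..b})" for t
        unfolding h_def using has_field_derivative_at_within[OF p'(2)[of t], of "{a..b}"]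
        by (auto intro!: derivative_eq_intros)
      show "continuous_on {a..b} (\<lambda>t. p' t - s)"
        using pc by (intro continuous_intros)
    qed (use ab in \<open>auto simp: h_def s_def\<close>)
    have hc: "continuous_on {a..b} h" using hH by (intro abs_continuous_imp_continuous_on H1_abs_continuous)
    \<comment> \<open>The constant 4 adds up the errors: one \<open>\<epsilon>\<close> from
      \<open>r - p\<close>, one from \<open>p a\<close>, and two from the chord increment
      \<open>p b - p a\<close>, all because \<open>r\<close> vanishes at \<open>a\<close> and
      \<open>b\<close>.\<close>
    have rh: "\<bar>r t - h t\<bar> \<le> 4 * \<epsilon>" if t: "t \<in> {a..b}" for t
    proof -
      have 1: "\<bar>r t - p t\<bar> < \<epsilon>" "\<bar>p a\<bar> < \<epsilon>" "\<bar>p b\<bar> < \<epsilon>"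
        using p(2)[OF t] p(2)[of a] p(2)[of b] ab r by auto
      have "\<bar>(t - a) / (b - a)\<bar> \<le> 1" using t ab by auto
      then have "\<bar>(p b - p a) * ((t - a) / (b - a))\<bar> \<le> \<bar>p b - p a\<bar> * 1"
        by (subst abs_mult) (rule mult_left_mono, simp_all)
      moreover have "s * (t - a) = (p b - p a) * ((t - a) / (b - a))" by (simp add: s_def)
      ultimately have "\<bar>s * (t - a)\<bar> \<le> \<bar>p b - p a\<bar>" by (simp only: mult_1_right)
      then show ?thesis using 1 unfolding h_def by linarith
    qed
    have "(LINT t|?M. q t * r t) = (LINT t|?M. q t * r t) - (LINT t|?M. q t * h t)"
      using H[OF hH] by simp
    also have "\<dots> = (LINT t|?M. q t * r t - q t * h t)"
      using iq[OF r(1)] iq[OF hc] by simp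
    finally have "\<bar>LINT t|?M. q t * r t\<bar> = \<bar>LINT t|?M. q t * r t - q t * h t\<bar>" by simp
    also have "\<dots> \<le> (LINT t|?M. \<bar>q t\<bar> * (4 * \<epsilon>))"
    proof (rule integral_abs_bound_integral)
      show "integrable ?M (\<lambda>t. q t * r t - q t * h t)" using iq[OF r(1)] iq[OF hc] by simp
      show "integrable ?M (\<lambda>t. \<bar>q t\<bar> * (4 * \<epsilon>))" using q by simp
      fix t assume "t \<in> space ?M"
      then have "\<bar>r t - h t\<bar> \<le> 4 * \<epsilon>" using rh by simp
      then show "\<bar>q t * r t - q t * h t\<bar> \<le> \<bar>q t\<bar> * (4 * \<epsilon>)"
        by (metis abs_ge_zero abs_mult mult_left_mono right_diff_distrib)
    qed
    also have "\<dots> = (4 * (LINT t|?M. \<bar>q t\<bar>)) * \<epsilon>" by simp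
    finally show ?thesis .
  qed
  define C where "C = 4 * (LINT t|?M. \<bar>q t\<bar>)"
  have C: "C \<ge> 0" unfolding C_def by simp
  have "\<bar>LINT t|?M. q t * r t\<bar> \<le> 0"
  proof (rule field_le_epsilon)
    fix e :: real assume e: "e > 0"
    have "\<bar>LINT t|?M. q t * r t\<bar> \<le> C * (e / (C + 1))"
      unfolding C_def by (rule bound) (use e C in \<open>simp add: C_def[symmetric]\<close>)
    also have "\<dots> \<le> e" using e C by (simp add: field_simps)
    finally show "\<bar>LINT t|?M. q t * r t\<bar> \<le> 0 + e" by simp
  qed
  then show ?thesis by simp
qed

text \<open>
  With \<open>k\<close> the difference of \<open>g\<close> and the candidate \<open>R\<close>, testing against \<open>\<rho>/E\<close> for \<open>\<rho>' = k - mean k\<close>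
  gives \<open>\<integral> (k - mean k)\<^sup>2 = 0\<close>.
\<close>

lemma weak_eigenvalueE:
  assumes ab: "a < b" and w: "continuous_on {a..b} w" and l: "l \<in> weak_eigenvalues a b w"
  obtains e g where "sturm_liouville a b (ito_exp w) l e g"
proof -
  let ?M = "lebesgue_on {a..b}" and ?E = "ito_exp w"
  obtain e g where eH: "e \<in> H1 a b" and fac: "ac_factor a b w (deriv e) g" and nz: "\<exists>t\<in>{a..b}. e t \<noteq> 0"
    and eig: "\<And>h. h \<in> H1 a b \<Longrightarrow> weak_L a b w e h = inner_L2 a b (\<lambda>t. l * e t) h"
    using l unfolding weak_eigenvalues_def weak_L_domain_def by blast
  have eac: "abs_continuous a b e" and e0: "e a = 0" "e b = 0" using eH by (auto simp: H1_def)
  have gac: "abs_continuous a b g" and AEe: "AE t in ?M. deriv e t = ?E t * g t"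
    using fac by (auto simp: ac_factor_def)
  have cE: "continuous_on {a..b} ?E" using w by (rule continuous_on_ito_exp)
  have cg: "continuous_on {a..b} g" and ce: "continuous_on {a..b} e"
    using gac eac by (auto intro: abs_continuous_imp_continuous_on)
  have Epos: "?E t > 0" for t by (rule ito_exp_pos)
  have E0: "?E t \<noteq> 0" for t using Epos[of t] by linarith
  have de: "(e has_real_derivative ?E t * g t) (at t within {a..b})" if "t \<in> {a..b}" for t
    using eac _ AEe that by (rule abs_continuous_continuous_deriv) (intro continuous_intros cE cg)
  define q where "q t = ?E t * deriv g t - 2 * l * e t" for t
  have iEg: "integrable ?M (\<lambda>t. ?E t * deriv g t)"
    using cE gac by (intro integrable_continuous_mult integrable_deriv)
  have q: "integrable ?M q"
    unfolding q_def using ce by (intro Bochner_Integration.integrable_diff iEg integrable_continuous_lebesgue_on continuous_intros)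
  have test: "(LINT t|?M. q t * h t) = 0" if h: "h \<in> H1 a b" for h
  proof -
    have ch: "continuous_on {a..b} h" using h by (intro abs_continuous_imp_continuous_on H1_abs_continuous)
    have i1: "integrable ?M (\<lambda>t. ?E t * deriv g t * h t)"
      using integrable_continuous_mult[OF ch iEg] by (simp add: mult.commute)
    have i2: "integrable ?M (\<lambda>t. 2 * (l * e t * h t))"
      using ce ch by (intro integrable_continuous_lebesgue_on continuous_intros)
    have "(LINT t|?M. q t * h t) = (LINT t|?M. ?E t * deriv g t * h t - 2 * (l * e t * h t))"
      by (rule arg_cong[where f = "integral\<^sup>L ?M"]) (auto simp: fun_eq_iff q_def algebra_simps)
    also have "\<dots> = (LINT t|?M. ?E t * deriv g t * h t) - (LINT t|?M. 2 * (l * e t * h t))"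
      using i1 i2 by (rule Bochner_Integration.integral_diff)
    also have "\<dots> = 0"
      using eig[OF h] unfolding weak_L_eq[OF ab w eac fac h] inner_L2_def by simp
    finally show ?thesis .
  qed
  define c where "c t = 2 * l * e t / ?E t" for t
  \<comment> \<open>\<open>R\<close> has the derivative that \<open>g\<close> ought to have, so the
    goal becomes that \<open>k = g - R\<close> is constant.\<close>
  define R where "R t = integral {a..t} c" for t
  have cc: "continuous_on {a..b} c" unfolding c_def using ce cE E0 by (intro continuous_intros) auto
  have dR: "(R has_real_derivative c t) (at t within {a..b})" if "t \<in> {a..b}" for t
    unfolding R_def using cc that by (rule integral_has_real_derivative)
  have Rac: "abs_continuous a b R" using dR cc by (rule abs_continuous_C1)
  have AER: "AE t in ?M. deriv R t = c t" using dR by (rule AE_deriv_within_Icc)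
  have cR: "continuous_on {a..b} R" using Rac by (rule abs_continuous_imp_continuous_on)
  define k where "k t = g t - R t" for t
  have ck: "continuous_on {a..b} k" unfolding k_def using cg cR by (intro continuous_intros)
  \<comment> \<open>Subtracting the mean makes \<rho> vanish at \<open>b\<close> as well as at
    \<open>a\<close>.\<close>
  define m where "m = integral {a..b} k / (b - a)"
  define \<rho> where "\<rho> t = integral {a..t} (\<lambda>x. k x - m)" for t
  have ckm: "continuous_on {a..b} (\<lambda>x. k x - m)" using ck by (intro continuous_intros)
  have d\<rho>: "(\<rho> has_real_derivative k t - m) (at t within {a..b})" if "t \<in> {a..b}" for t
    unfolding \<rho>_def using ckm that by (rule integral_has_real_derivative)
  have AE\<rho>: "AE t in ?M. deriv \<rho> t = k t - m" using d\<rho> by (rule AE_deriv_within_Icc)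
  have \<rho>ac: "abs_continuous a b \<rho>" using d\<rho> ckm by (rule abs_continuous_C1)
  have c\<rho>: "continuous_on {a..b} \<rho>" using \<rho>ac by (rule abs_continuous_imp_continuous_on)
  have int0: "integral {a..b} (\<lambda>x. k x - m) = 0"
    using ab ck by (subst integral_diff) (auto simp: m_def intro!: integrable_continuous_real)
  have \<rho>0: "\<rho> a = 0" "\<rho> b = 0" using int0 by (simp_all add: \<rho>_def)
  have parts: "(LINT t|?M. deriv f t * \<rho> t) = - (LINT t|?M. f t * (k t - m))"
    if f: "abs_continuous a b f" for f
  proof -
    have cf: "continuous_on {a..b} f" using f by (rule abs_continuous_imp_continuous_on)
    have "(LINT t|?M. f t * deriv \<rho> t) = (LINT t|?M. f t * (k t - m))"
    proof (intro integral_cong_AE)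
      show "(\<lambda>t. f t * deriv \<rho> t) \<in> borel_measurable ?M"
        using cf \<rho>ac by (intro borel_measurable_integrable integrable_continuous_mult integrable_deriv)
      show "(\<lambda>t. f t * (k t - m)) \<in> borel_measurable ?M"
        using cf ckm by (intro borel_measurable_integrable integrable_continuous_lebesgue_on continuous_on_mult)
      show "AE t in ?M. f t * deriv \<rho> t = f t * (k t - m)"
        using AE\<rho> by eventually_elim simp
    qed
    then show ?thesis using integration_by_parts[OF less_imp_le[OF ab] f \<rho>ac \<rho>0] by simp
  qed
  have ig\<rho>: "integrable ?M (\<lambda>t. deriv f t * \<rho> t)" if f: "abs_continuous a b f" for f
    using integrable_continuous_mult[OF c\<rho> integrable_deriv[OF f]] by (simp add: mult.commute)
  \<comment> \<open>Dividing by E cancels the weight in front of \<open>deriv g\<close> and leaves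
    \<open>(deriv g - deriv R) * \<rho>\<close>. The quotient \<rho>/E is known only to be
    continuous, which is why the test relation was extended beyond \<open>H1\<close>.\<close>
  have "0 = (LINT t|?M. q t * (\<rho> t / ?E t))"
    using ab q test \<rho>0 c\<rho> cE E0 by (intro H1_test_continuous[symmetric]) (auto intro!: continuous_intros)
  also have "\<dots> = (LINT t|?M. deriv g t * \<rho> t - deriv R t * \<rho> t)"
  proof (intro integral_cong_AE)
    show "(\<lambda>t. q t * (\<rho> t / ?E t)) \<in> borel_measurable ?M"
      using integrable_continuous_mult[OF _ q, of "\<lambda>t. \<rho> t / ?E t"] c\<rho> cE E0
      by (auto simp: mult.commute intro!: borel_measurable_integrable continuous_intros)
    show "(\<lambda>t. deriv g t * \<rho> t - deriv R t * \<rho> t) \<in> borel_measurable ?M"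
      using ig\<rho>[OF gac] ig\<rho>[OF Rac] by auto
    show "AE t in ?M. q t * (\<rho> t / ?E t) = deriv g t * \<rho> t - deriv R t * \<rho> t"
      using AER
    proof eventually_elim
      case (elim t)
      show ?case unfolding elim q_def c_def using E0[of t] by (simp add: field_simps)
    qed
  qed
  also have "\<dots> = (LINT t|?M. deriv g t * \<rho> t) - (LINT t|?M. deriv R t * \<rho> t)"
    using ig\<rho>[OF gac] ig\<rho>[OF Rac] by simp
  also have "\<dots> = (LINT t|?M. R t * (k t - m)) - (LINT t|?M. g t * (k t - m))"
    using parts[OF gac] parts[OF Rac] by simp
  also have "\<dots> = (LINT t|?M. R t * (k t - m) - g t * (k t - m))"
    using cR cg ckm by (intro Bochner_Integration.integral_diff[symmetric] integrable_continuous_lebesgue_on continuous_on_mult)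
  also have "\<dots> = integral {a..b} (\<lambda>t. R t * (k t - m) - g t * (k t - m))"
    using cR cg ck
    by (intro lebesgue_integral_eq_integral integrable_continuous_lebesgue_on continuous_intros) auto
  \<comment> \<open>Since \<open>R - g = - k = - m - (k - m)\<close>; the term with the factor
    \<open>m\<close> integrates to 0.\<close>
  also have "\<dots> = integral {a..b} (\<lambda>t. - m * (k t - m) - (k t - m)\<^sup>2)"
    by (rule integral_cong) (simp add: k_def power2_eq_square algebra_simps)
  also have "\<dots> = - m * integral {a..b} (\<lambda>t. k t - m) - integral {a..b} (\<lambda>t. (k t - m)\<^sup>2)"
    using ckm by (subst integral_diff) (auto intro!: integrable_continuous_real continuous_intros)
  finally have "integral {a..b} (\<lambda>t. (k t - m)\<^sup>2) = 0" using int0 by simp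
  moreover have "continuous_on {a..b} (\<lambda>t. (k t - m)\<^sup>2)" using ck by (intro continuous_intros)
  ultimately have km: "k t = m" if "t \<in> {a..b}" for t
    using ab that integral_eq_0_iff[of a b "\<lambda>t. (k t - m)\<^sup>2"] by simp
  have "(g has_real_derivative c t) (at t within {a..b})" if t: "t \<in> {a..b}" for t
  proof (rule has_field_derivative_transform_within[OF _ zero_less_one t])
    show "((\<lambda>t. m + R t) has_real_derivative c t) (at t within {a..b})"
      using dR[OF t] by (auto intro!: derivative_eq_intros)
    show "m + R x = g x" if "x \<in> {a..b}" for x using km[OF that] by (simp add: k_def)
  qed
  then have "sturm_liouville a b ?E l e g"
    unfolding sturm_liouville_def using de e0 nz by (auto simp: c_def)
  then show ?thesis by (rule that)
qed

section \<open>Countability of the spectrum\<close>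

text \<open>Lagrange's identity: the Wronskian-type expression \<open>e1 * g2 - e2 * g1\<close> has
  derivative \<open>2 * (l2 - l1) * e1 * e2 / E\<close>, as the terms \<open>E * g1 * g2\<close>
  cancel, and it vanishes at both ends by the boundary conditions.\<close>

lemma sturm_liouville_orthogonal:
  assumes ab: "a < b" and E: "continuous_on {a..b} E" "\<And>t. E t > 0"
    and 1: "sturm_liouville a b E l1 e1 g1" and 2: "sturm_liouville a b E l2 e2 g2" and ne: "l1 \<noteq> l2"
  shows "integral {a..b} (\<lambda>t. e1 t * e2 t / E t) = 0"
proof -
  have d: "((\<lambda>t. e1 t * g2 t - e2 t * g1 t) has_real_derivative 2 * (l2 - l1) * (e1 t * e2 t / E t)) (at t within {a..b})"
    if t: "t \<in> {a..b}" for t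
  proof -
    have "(e1 has_real_derivative E t * g1 t) (at t within {a..b})"
      "(g1 has_real_derivative 2 * l1 * e1 t / E t) (at t within {a..b})"
      "(e2 has_real_derivative E t * g2 t) (at t within {a..b})"
      "(g2 has_real_derivative 2 * l2 * e2 t / E t) (at t within {a..b})"
      using 1 2 t by (auto simp: sturm_liouville_def)
    note this[derivative_intros]
    show ?thesis
      using E(2)[of t] by (auto intro!: derivative_eq_intros simp: field_simps)
  qed
  have "((\<lambda>t. 2 * (l2 - l1) * (e1 t * e2 t / E t)) has_integral
      (e1 b * g2 b - e2 b * g1 b) - (e1 a * g2 a - e2 a * g1 a)) {a..b}"
    using ab d by (intro fundamental_theorem_of_calculus)
      (auto simp: has_real_derivative_iff_has_vector_derivative[symmetric])
  then have "((\<lambda>t. 2 * (l2 - l1) * (e1 t * e2 t / E t)) has_integral 0) {a..b}"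
    using 1 2 by (simp add: sturm_liouville_def)
  then have "2 * (l2 - l1) * integral {a..b} (\<lambda>t. e1 t * e2 t / E t) = 0"
    by (subst integral_mult_right[symmetric]) (rule integral_unique)
  then show ?thesis using ne by simp
qed

text \<open>Bessel's inequality in the space with weight \<open>r\<close> for the indicator of
  \<open>[a, q]\<close>. The bound is the total mass of \<open>r\<close>, so it is the same for
  every \<open>q\<close> and every finite orthonormal family.\<close>

lemma bessel_indicator:
  fixes e :: "'i \<Rightarrow> real \<Rightarrow> real"
  assumes ab: "a < b" and r: "continuous_on {a..b} r" "\<And>t. t \<in> {a..b} \<Longrightarrow> r t \<ge> 0"
    and e: "\<And>i. i \<in> I \<Longrightarrow> continuous_on {a..b} (e i)" and fin: "finite I"
    and orth: "\<And>i j. i \<in> I \<Longrightarrow> j \<in> I \<Longrightarrow> integral {a..b} (\<lambda>t. e i t * e j t * r t) = (if i = j then 1 else 0)"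
    and q: "a \<le> q" "q \<le> b"
  shows "(\<Sum>i\<in>I. (integral {a..q} (\<lambda>t. e i t * r t))\<^sup>2) \<le> integral {a..b} r"
proof -
  define c where "c i = integral {a..q} (\<lambda>t. e i t * r t)" for i
  define s where "s t = (\<Sum>i\<in>I. c i * e i t)" for t
  have sub: "{a..q} \<subseteq> {a..b}" using q by auto
  have cs: "continuous_on {a..b} s" unfolding s_def using e by (intro continuous_intros)
  have int_b: "f integrable_on {a..b}" and int_q: "f integrable_on {a..q}" if "continuous_on {a..b} f" for f :: "real \<Rightarrow> real"
    using that continuous_on_subset[OF that sub] by (auto intro: integrable_continuous_real)
  have s2: "integral {a..b} (\<lambda>t. (s t)\<^sup>2 * r t) = (\<Sum>i\<in>I. (c i)\<^sup>2)"
  proof -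
    have "integral {a..b} (\<lambda>t. (s t)\<^sup>2 * r t) = integral {a..b} (\<lambda>t. \<Sum>i\<in>I. \<Sum>j\<in>I. c i * c j * (e i t * e j t * r t))"
      by (rule integral_cong) (simp add: s_def power2_eq_square sum_product sum_distrib_left sum_distrib_right mult_ac)
    also have "\<dots> = (\<Sum>i\<in>I. \<Sum>j\<in>I. c i * c j * integral {a..b} (\<lambda>t. e i t * e j t * r t))"
      using fin e r(1) by (simp add: integral_sum integrable_sum int_b continuous_intros)
    also have "\<dots> = (\<Sum>i\<in>I. \<Sum>j\<in>I. if i = j then c i * c j else 0)"
      by (intro sum.cong refl) (simp add: orth)
    also have "\<dots> = (\<Sum>i\<in>I. (c i)\<^sup>2)"
      using fin by (simp add: power2_eq_square)
    finally show ?thesis .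
  qed
  have sr: "integral {a..q} (\<lambda>t. s t * r t) = (\<Sum>i\<in>I. (c i)\<^sup>2)"
  proof -
    have "integral {a..q} (\<lambda>t. s t * r t) = integral {a..q} (\<lambda>t. \<Sum>i\<in>I. c i * (e i t * r t))"
      by (rule integral_cong) (simp add: s_def sum_distrib_left sum_distrib_right mult_ac)
    also have "\<dots> = (\<Sum>i\<in>I. c i * integral {a..q} (\<lambda>t. e i t * r t))"
      using fin e r(1) by (simp add: integral_sum int_q continuous_intros)
    finally show ?thesis by (simp add: c_def power2_eq_square)
  qed
  \<comment> \<open>The square is integrated over \<open>[a, q]\<close> only, where the indicator is
    1. The term with \<open>s\<close> squared is afterwards enlarged to \<open>[a, b]\<close>, where
    orthonormality evaluates it; the mixed term counts the same sum twice with a minus sign.\<close>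
  have "0 \<le> integral {a..q} (\<lambda>t. (1 - s t)\<^sup>2 * r t)"
    using r cs sub by (intro integral_nonneg int_q continuous_intros) auto
  also have "\<dots> = integral {a..q} (\<lambda>t. (r t - 2 * (s t * r t)) + (s t)\<^sup>2 * r t)"
    by (rule integral_cong) (simp add: power2_eq_square algebra_simps)
  also have "\<dots> = integral {a..q} r - 2 * integral {a..q} (\<lambda>t. s t * r t) + integral {a..q} (\<lambda>t. (s t)\<^sup>2 * r t)"
    using r(1) cs by (simp add: integral_add integral_diff integrable_diff int_q continuous_intros)
  also have "integral {a..q} (\<lambda>t. (s t)\<^sup>2 * r t) \<le> integral {a..b} (\<lambda>t. (s t)\<^sup>2 * r t)"
    using r cs sub by (intro integral_subset_le int_q int_b continuous_intros) auto
  also have "integral {a..q} r \<le> integral {a..b} r"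
    using r sub by (intro integral_subset_le int_q int_b) auto
  finally show ?thesis unfolding s2 sr c_def by simp
qed

text \<open>The primitive is continuous and vanishes on a dense set, hence everywhere on
  \<open>[a, b]\<close>, and so does its derivative \<open>f\<close>.\<close>

lemma integral_zero_rationals_imp_zero:
  fixes f :: "real \<Rightarrow> real"
  assumes ab: "a < b" and f: "continuous_on {a..b} f"
    and z: "\<And>q. q \<in> \<rat> \<Longrightarrow> a \<le> q \<Longrightarrow> q \<le> b \<Longrightarrow> integral {a..q} f = 0" and t: "t \<in> {a..b}"
  shows "f t = 0"
proof -
  define F where "F x = integral {a..x} f" for x
  have d: "(F has_real_derivative f x) (at x within {a..b})" if "x \<in> {a..b}" for x
    unfolding F_def using f that by (rule integral_has_real_derivative)
  have cF: "continuous_on {a..b} F" using d by (rule DERIV_continuous_on)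
  have cl: "closed {x \<in> {a..b}. F x = 0}"
    using continuous_closed_preimage_constant[OF cF] by simp
  have "{a<..<b} \<subseteq> closure ({a<..<b} \<inter> \<rat>)"
    using open_Int_closure_subset[of "{a<..<b}" "\<rat>"] by (simp add: Rats_closure_real)
  also have "closure ({a<..<b} \<inter> \<rat>) \<subseteq> {x \<in> {a..b}. F x = 0}"
  proof (rule closure_minimal[OF _ cl], rule subsetI)
    fix x assume "x \<in> {a<..<b} \<inter> \<rat>"
    then show "x \<in> {x \<in> {a..b}. F x = 0}" using z[of x] by (simp add: F_def)
  qed
  finally have "{a<..<b} \<subseteq> {x \<in> {a..b}. F x = 0}" .
  then have "closure {a<..<b} \<subseteq> {x \<in> {a..b}. F x = 0}" using cl by (rule closure_minimal)
  then have F0: "F x = 0" if "x \<in> {a..b}" for x using that ab by auto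
  have "((\<lambda>x. 0) has_real_derivative f t) (at t within {a..b})"
    by (rule has_field_derivative_transform_within[OF d[OF t] zero_less_one t]) (rule F0)
  moreover have "((\<lambda>x. 0) has_real_derivative 0) (at t within {a..b})" by simp
  ultimately show ?thesis
    using vector_derivative_unique_within_closed_interval[of a b t "\<lambda>x. 0" "f t" 0] ab t
    by (simp add: has_real_derivative_iff_has_vector_derivative)
qed

theorem countable_sturm_liouville:
  assumes ab: "a < b" and E: "continuous_on {a..b} E" "\<And>t. E t > 0"
  shows "countable {l. \<exists>e g. sturm_liouville a b E l e g}" (is "countable ?L")
proof -
  define r where "r t = 1 / E t" for t
  have E0: "E t \<noteq> 0" for t using E(2)[of t] by linarith
  have r: "continuous_on {a..b} r" "r t > 0" for t
    using E E0 unfolding r_def by (auto intro!: continuous_intros)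
  \<comment> \<open>One eigenfunction is selected per eigenvalue, so the orthogonal family is
    indexed by the eigenvalues themselves and counting the one counts the other.\<close>
  have "\<forall>l. \<exists>e g. l \<in> ?L \<longrightarrow> sturm_liouville a b E l e g" by auto
  then obtain e0 g0 where sl: "l \<in> ?L \<Longrightarrow> sturm_liouville a b E l (e0 l) (g0 l)" for l
    by metis
  have ce0: "continuous_on {a..b} (e0 l)" if "l \<in> ?L" for l
    using sl[OF that] unfolding sturm_liouville_def by (intro DERIV_continuous_on) blast
  define N where "N l = integral {a..b} (\<lambda>t. (e0 l t)\<^sup>2 * r t)" for l
  have N: "N l > 0" if l: "l \<in> ?L" for l
  proof -
    have c: "continuous_on {a..b} (\<lambda>t. (e0 l t)\<^sup>2 * r t)" using ce0[OF l] r by (intro continuous_intros)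
    have nn: "0 \<le> (e0 l t)\<^sup>2 * r t" for t using r(2)[of t] by simp
    have "N l \<ge> 0" unfolding N_def using c nn by (intro integral_nonneg integrable_continuous_real) auto
    moreover have "N l \<noteq> 0"
    proof
      assume "N l = 0"
      then have "\<forall>t\<in>{a..b}. (e0 l t)\<^sup>2 * r t = 0"
        using integral_eq_0_iff[OF c ab] nn by (simp add: N_def)
      then have "\<forall>t\<in>{a..b}. e0 l t = 0" using r(2) by (metis less_irrefl mult_eq_0_iff power2_eq_square)
      then show False using sl[OF l] by (auto simp: sturm_liouville_def)
    qed
    ultimately show ?thesis by simp
  qed
  define e where "e l t = e0 l t / sqrt (N l)" for l t
  have ce: "continuous_on {a..b} (e l)" if "l \<in> ?L" for l
    unfolding e_def using ce0[OF that] N[OF that] by (intro continuous_intros) auto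
  have orth: "integral {a..b} (\<lambda>t. e l t * e m t * r t) = (if l = m then 1 else 0)"
    if l: "l \<in> ?L" and m: "m \<in> ?L" for l m
  proof -
    have "integral {a..b} (\<lambda>t. e l t * e m t * r t)
        = integral {a..b} (\<lambda>t. (1 / (sqrt (N l) * sqrt (N m))) * (e0 l t * e0 m t * r t))"
      by (rule integral_cong) (simp add: e_def)
    also have "\<dots> = (1 / (sqrt (N l) * sqrt (N m))) * integral {a..b} (\<lambda>t. e0 l t * e0 m t * r t)"
      by (rule integral_mult_right)
    also have "\<dots> = (if l = m then 1 else 0)"
    proof (cases "l = m")
      case True
      have "integral {a..b} (\<lambda>t. e0 l t * e0 m t * r t) = N l"
        unfolding N_def True power2_eq_square ..
      then show ?thesis using True N[OF l] by simp
    next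
      case False
      have "integral {a..b} (\<lambda>t. e0 l t * e0 m t * r t) = 0"
        using sturm_liouville_orthogonal[OF ab E sl[OF l] sl[OF m] False] by (simp add: r_def)
      then show ?thesis using False by simp
    qed
    finally show ?thesis .
  qed
  define c where "c q l = (integral {a..q} (\<lambda>t. e l t * r t))\<^sup>2" for q l
  define K where "K = integral {a..b} r"
  \<comment> \<open>If \<open>k\<close> coefficients exceed \<open>1 / Suc n\<close>, Bessel gives
    \<open>k / Suc n \<le> K\<close>. The choice of \<open>k\<close> just above
    \<open>K * Suc n\<close> contradicts this.\<close>
  have fin: "finite {l \<in> ?L. c q l > 1 / real (Suc n)}" (is "finite ?F") if q: "a \<le> q" "q \<le> b" for q n
  proof (rule ccontr)
    assume inf: "infinite ?F"
    define k where "k = nat \<lceil>K * real (Suc n)\<rceil> + 1"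
    have k: "real k > K * real (Suc n)" unfolding k_def by linarith
    obtain I where I: "I \<subseteq> ?F" "finite I" "card I = k" using infinite_arbitrarily_large[OF inf] by blast
    have "real k / real (Suc n) = (\<Sum>l\<in>I. 1 / real (Suc n))" using I(3) by simp
    also have "\<dots> \<le> (\<Sum>l\<in>I. c q l)" using I(1) by (intro sum_mono) auto
    also have "\<dots> \<le> K"
      unfolding c_def K_def
    proof (rule bessel_indicator[OF ab r(1) _ _ I(2) _ q])
      show "0 \<le> r t" for t using r(2)[of t] by simp
    qed (use ce orth I(1) in blast)+
    finally show False using k by (simp add: field_simps)
  qed
  have "?L \<subseteq> (\<Union>q\<in>\<rat> \<inter> {a..b}. \<Union>n. {l \<in> ?L. c q l > 1 / real (Suc n)})"
  proof
    fix l assume l: "l \<in> ?L"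
    show "l \<in> (\<Union>q\<in>\<rat> \<inter> {a..b}. \<Union>n. {l \<in> ?L. c q l > 1 / real (Suc n)})"
    proof (rule ccontr)
      assume "\<not> ?thesis"
      then have no: "c q l \<le> 1 / real (Suc n)" if "q \<in> \<rat>" "a \<le> q" "q \<le> b" for q n
        using l that by (force simp: not_less)
      have "integral {a..q} (\<lambda>t. e l t * r t) = 0" if q: "q \<in> \<rat>" "a \<le> q" "q \<le> b" for q
      proof (rule ccontr)
        assume "integral {a..q} (\<lambda>t. e l t * r t) \<noteq> 0"
        then have "c q l > 0" by (simp add: c_def)
        then obtain n where "inverse (real (Suc n)) < c q l" using reals_Archimedean by blast
        then show False using no[OF q, of n] by (simp add: inverse_eq_divide)
      qed
      then have "e l t * r t = 0" if "t \<in> {a..b}" for t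
        using ab ce[OF l] r(1) that
        by (intro integral_zero_rationals_imp_zero[of a b "\<lambda>t. e l t * r t"] continuous_intros) auto
      then have "e0 l t = 0" if "t \<in> {a..b}" for t
        using that r(2)[of t] N[OF l] by (fastforce simp: e_def)
      then show False using sl[OF l] by (auto simp: sturm_liouville_def)
    qed
  qed
  moreover have "countable (\<Union>q\<in>\<rat> \<inter> {a..b}. \<Union>n. {l \<in> ?L. c q l > 1 / real (Suc n)})"
    using fin by (intro countable_UN countable_Int1 countable_rat countableI_type) (auto intro!: countable_UN uncountable_infinite countable_finite)
  ultimately show ?thesis by (rule countable_subset)
qed

section \<open>Infinitude of the spectrum\<close>

text \<open>
  Picard iteration as a contraction of factor \<open>1/2\<close> in the norm weighted by \<open>exp (- \<beta> (t - a))\<close>,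
  which needs no smallness of the interval; varying the contraction with the parameter \<open>s\<close> gives
  continuity in \<open>s\<close>. The argument \<open>t\<close> is clamped to \<open>[a, b]\<close> to stay with total functions.
\<close>

lemma ode_solution_continuous_in_parameter:
  fixes G :: "real \<Rightarrow> real \<Rightarrow> real"
  assumes ab: "a < b" and G: "continuous_on ({a..b} \<times> UNIV) (\<lambda>(t, x). G t x)"
    and lip: "\<And>t x y. t \<in> {a..b} \<Longrightarrow> \<bar>G t x - G t y\<bar> \<le> K * \<bar>x - y\<bar>" and K: "K \<ge> 0" and S: "S \<ge> 0"
  obtains \<theta> :: "real \<Rightarrow> real \<Rightarrow> real" where
    "\<And>s. s \<in> {0..S} \<Longrightarrow> \<theta> s a = 0"
    "\<And>s t. s \<in> {0..S} \<Longrightarrow> t \<in> {a..b} \<Longrightarrow> (\<theta> s has_real_derivative s * G t (\<theta> s t)) (at t within {a..b})"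
    "continuous_on {0..S} (\<lambda>s. \<theta> s b)"
proof -
  \<comment> \<open>Large enough that the Lipschitz factor \<open>s * K / \<beta>\<close> is at most
    \<open>1/2\<close> for all \<open>s \<le> S\<close>; the summand 1 keeps \<beta> positive when
    \<open>S * K = 0\<close>.\<close>
  define \<beta> where "\<beta> = 2 * (S * K) + 1"
  have \<beta>: "\<beta> > 0" "2 * (S * K) \<le> \<beta>" using K S by (auto simp: \<beta>_def intro: add_nonneg_pos)
  define ct where "ct t = max a (min b t)" for t
  have ct: "continuous_on UNIV ct" "ct t \<in> {a..b}" "t \<in> {a..b} \<Longrightarrow> ct t = t" for t
    using ab by (auto simp: ct_def intro!: continuous_intros)
  \<comment> \<open>The unknown \<open>v\<close> is the solution times
    \<open>exp (- \<beta> * (x - a))\<close>. Undoing the weight inside \<open>G\<close> lets the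
    supremum distance of bounded continuous functions act as the weighted distance of
    solutions.\<close>
  define g where "g v x = G x (exp (\<beta> * (x - a)) * apply_bcontfun v x)" for v :: "real \<Rightarrow>\<^sub>C real" and x
  have cg: "continuous_on {a..b} (g v)" for v
  proof -
    have "continuous_on {a..b} (\<lambda>x. (\<lambda>(t, x). G t x) (x, exp (\<beta> * (x - a)) * apply_bcontfun v x))"
      by (rule continuous_on_compose2[OF G]) (auto intro!: continuous_intros)
    then show ?thesis by (simp add: g_def)
  qed
  define P where "P v t = integral {a..t} (g v)" for v t
  have dP: "(P v has_real_derivative g v t) (at t within {a..b})" if "t \<in> {a..b}" for v t
    unfolding P_def using cg that by (rule integral_has_real_derivative)
  have cP: "continuous_on {a..b} (P v)" for v using dP by (rule DERIV_continuous_on)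
  have g_lip: "\<bar>g v x - g v' x\<bar> \<le> K * (exp (\<beta> * (x - a)) * dist v v')" if x: "x \<in> {a..b}" for v v' x
  proof -
    have "\<bar>g v x - g v' x\<bar> \<le> K * \<bar>exp (\<beta> * (x - a)) * apply_bcontfun v x - exp (\<beta> * (x - a)) * apply_bcontfun v' x\<bar>"
      unfolding g_def using x by (rule lip)
    also have "\<dots> = K * (exp (\<beta> * (x - a)) * dist (apply_bcontfun v x) (apply_bcontfun v' x))"
      by (simp add: dist_real_def abs_mult right_diff_distrib[symmetric])
    also have "\<dots> \<le> K * (exp (\<beta> * (x - a)) * dist v v')"
      using K by (intro mult_left_mono dist_bounded) auto
    finally show ?thesis .
  qed
  \<comment> \<open>Integrating the growth \<open>exp (\<beta> * (x - a))\<close> gains the factor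
    \<open>1 / \<beta>\<close>, and the outer weight cancels what remains of the
    exponential.\<close>
  have P_lip: "exp (- \<beta> * (t - a)) * \<bar>P v t - P v' t\<bar> \<le> K / \<beta> * dist v v'" if t: "t \<in> {a..b}" for v v' t
  proof -
    define D where "D = K * dist v v'"
    have D: "D \<ge> 0" using K by (simp add: D_def)
    have cgt: "continuous_on {a..t} (g u)" for u using cg by (rule continuous_on_subset) (use t in auto)
    have "((\<lambda>x. D * exp (\<beta> * (x - a))) has_integral D / \<beta> * exp (\<beta> * (t - a)) - D / \<beta> * exp (\<beta> * (a - a))) {a..t}"
      using t \<beta>(1) by (intro fundamental_theorem_of_calculus)
        (auto simp: has_real_derivative_iff_has_vector_derivative[symmetric] intro!: derivative_eq_intros)
    from integral_unique[OF this]
    have I: "integral {a..t} (\<lambda>x. D * exp (\<beta> * (x - a))) \<le> D / \<beta> * exp (\<beta> * (t - a))"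
      using divide_nonneg_pos[OF D \<beta>(1)] by (simp only:) simp
    have "\<bar>P v t - P v' t\<bar> = \<bar>integral {a..t} (\<lambda>x. g v x - g v' x)\<bar>"
      unfolding P_def using cgt by (subst integral_diff) (auto intro: integrable_continuous_real)
    also have "\<dots> \<le> integral {a..t} (\<lambda>x. D * exp (\<beta> * (x - a)))"
      unfolding real_norm_def[symmetric]
    proof (rule Henstock_Kurzweil_Integration.integral_norm_bound_integral)
      show "(\<lambda>x. g v x - g v' x) integrable_on {a..t}" using cgt by (intro integrable_continuous_real continuous_intros)
      show "(\<lambda>x. D * exp (\<beta> * (x - a))) integrable_on {a..t}" by (intro integrable_continuous_real continuous_intros)
      fix x assume "x \<in> {a..t}"
      then show "norm (g v x - g v' x) \<le> D * exp (\<beta> * (x - a))"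
        using g_lip[of x v v'] t by (simp add: D_def mult_ac)
    qed
    also note I
    finally have "exp (- \<beta> * (t - a)) * \<bar>P v t - P v' t\<bar> \<le> exp (- \<beta> * (t - a)) * (D / \<beta> * exp (\<beta> * (t - a)))"
      by (intro mult_left_mono) auto
    also have "\<dots> = K / \<beta> * dist v v'"
      using mult_exp_exp[of "- \<beta> * (t - a)" "\<beta> * (t - a)"] by (simp add: D_def mult_ac)
    finally show ?thesis .
  qed
  define T where "T s v = Bcontfun (\<lambda>t. exp (- \<beta> * (ct t - a)) * (s * P v (ct t)))" for s v
  \<comment> \<open>\<open>Bcontfun\<close> can be unfolded only for functions known to be bounded
    and continuous on the whole line; both properties come from compactness of \<open>[a, b]\<close>
    through the clamp \<open>ct\<close>.\<close>
  have T: "apply_bcontfun (T s v) t = exp (- \<beta> * (ct t - a)) * (s * P v (ct t))" for s v t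
  proof -
    have c: "continuous_on {a..b} (\<lambda>t. exp (- \<beta> * (t - a)) * (s * P v t))" using cP by (intro continuous_intros)
    have "bounded ((\<lambda>t. exp (- \<beta> * (t - a)) * (s * P v t)) ` {a..b})"
      using c by (intro compact_imp_bounded compact_continuous_image) auto
    then obtain B where B: "\<And>t. t \<in> {a..b} \<Longrightarrow> norm (exp (- \<beta> * (t - a)) * (s * P v t)) \<le> B"
      unfolding bounded_iff by blast
    have "(\<lambda>t. exp (- \<beta> * (ct t - a)) * (s * P v (ct t))) \<in> bcontfun"
    proof (rule bcontfun_normI)
      show "continuous_on UNIV (\<lambda>t. exp (- \<beta> * (ct t - a)) * (s * P v (ct t)))"
        by (rule continuous_on_compose2[OF c ct(1)]) (use ct(2) in auto)
      show "norm (exp (- \<beta> * (ct t - a)) * (s * P v (ct t))) \<le> B" for t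
        by (rule B[OF ct(2)])
    qed
    then show ?thesis unfolding T_def by (simp add: Bcontfun_inverse)
  qed
  have T_lip: "dist (T s v) (T s v') \<le> 1 / 2 * dist v v'" if s: "s \<in> {0..S}" for s v v'
  proof (rule dist_bound)
    fix t
    have "dist (apply_bcontfun (T s v) t) (apply_bcontfun (T s v') t)
        = s * (exp (- \<beta> * (ct t - a)) * \<bar>P v (ct t) - P v' (ct t)\<bar>)"
      using s unfolding T dist_real_def by (simp add: abs_mult right_diff_distrib[symmetric])
    also have "\<dots> \<le> s * (K / \<beta> * dist v v')"
      using s P_lip[OF ct(2)] by (intro mult_left_mono) auto
    also have "\<dots> = (s * K / \<beta>) * dist v v'" by simp
    also have "\<dots> \<le> 1 / 2 * dist v v'"
    proof (rule mult_right_mono)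
      have "2 * (s * K) \<le> 2 * (S * K)" using s K by (auto intro: mult_right_mono)
      then show "s * K / \<beta> \<le> 1 / 2" using \<beta> by (simp add: field_simps)
    qed simp
    finally show "dist (apply_bcontfun (T s v) t) (apply_bcontfun (T s v') t) \<le> 1 / 2 * dist v v'" .
  qed
  have "\<exists>!v. T s v = v" if s: "s \<in> {0..S}" for s
    by (rule banach_fix_type[of "1 / 2"]) (use T_lip[OF s] in auto)
  then obtain V where V: "T s (V s) = V s" if "s \<in> {0..S}" for s by metis
  \<comment> \<open>The solution is taken in integrated form, which makes it differentiable at once;
    \<open>VT\<close> then identifies it with the unweighted fixed point.\<close>
  define \<theta> where "\<theta> s t = s * P (V s) (ct t)" for s t
  have VT: "exp (\<beta> * (t - a)) * apply_bcontfun (V s) t = \<theta> s t" if s: "s \<in> {0..S}" and t: "t \<in> {a..b}" for s t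
  proof -
    have "apply_bcontfun (V s) t = exp (- \<beta> * (t - a)) * \<theta> s t"
      using T[of s "V s" t] V[OF s] ct(3)[OF t] by (simp add: \<theta>_def)
    then show ?thesis by (simp add: exp_minus)
  qed
  show ?thesis
  proof (rule that[of \<theta>])
    fix s assume s: "s \<in> {0..S}"
    show "\<theta> s a = 0" using ct(3)[of a] ab by (simp add: \<theta>_def P_def)
    fix t assume t: "t \<in> {a..b}"
    have "((\<lambda>t. s * P (V s) t) has_real_derivative s * g (V s) t) (at t within {a..b})"
      using dP[OF t] by (auto intro!: derivative_eq_intros)
    moreover have "g (V s) t = G t (\<theta> s t)" using VT[OF s t] by (simp add: g_def)
    ultimately have "((\<lambda>t. s * P (V s) t) has_real_derivative s * G t (\<theta> s t)) (at t within {a..b})" by simp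
    then show "(\<theta> s has_real_derivative s * G t (\<theta> s t)) (at t within {a..b})"
      by (rule has_field_derivative_transform_within[OF _ zero_less_one t]) (simp add: \<theta>_def ct(3))
  next
    \<comment> \<open>The triangle inequality through \<open>T s' (V s)\<close> bounds the distance
      of the two fixed points by half of itself plus \<open>B * dist s' s\<close>, hence by
      \<open>2 * B * dist s' s\<close>. The constant \<open>2 * B + 1\<close> avoids division by
      0.\<close>
    have cV: "continuous_on {0..S} V"
      unfolding continuous_on_iff
    proof (intro ballI allI impI)
      fix s e :: real assume s: "s \<in> {0..S}" and e: "e > 0"
      have "bounded ((\<lambda>t. exp (- \<beta> * (t - a)) * P (V s) t) ` {a..b})"
        using cP by (intro compact_imp_bounded compact_continuous_image continuous_intros) auto
      then obtain B where B: "\<And>t. t \<in> {a..b} \<Longrightarrow> norm (exp (- \<beta> * (t - a)) * P (V s) t) \<le> B"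
        unfolding bounded_iff by blast
      have B0: "B \<ge> 0" using B[of a] ab norm_ge_zero order_trans by fastforce
      have "dist (V s') (V s) < e" if s': "s' \<in> {0..S}" and d: "dist s' s < e / (2 * B + 1)" for s'
      proof -
        have "dist (T s' (V s)) (T s (V s)) \<le> dist s' s * B"
        proof (rule dist_bound)
          fix t
          have "dist (apply_bcontfun (T s' (V s)) t) (apply_bcontfun (T s (V s)) t)
              = dist s' s * norm (exp (- \<beta> * (ct t - a)) * P (V s) (ct t))"
            unfolding T dist_real_def by (simp add: abs_mult right_diff_distrib[symmetric] left_diff_distrib[symmetric])
          also have "\<dots> \<le> dist s' s * B" using B[OF ct(2)] by (intro mult_left_mono) auto
          finally show "dist (apply_bcontfun (T s' (V s)) t) (apply_bcontfun (T s (V s)) t) \<le> dist s' s * B" .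
        qed
        moreover have "dist (T s' (V s')) (T s' (V s)) \<le> 1 / 2 * dist (V s') (V s)" using s' by (rule T_lip)
        moreover have "dist (V s') (V s) \<le> dist (T s' (V s')) (T s' (V s)) + dist (T s' (V s)) (T s (V s))"
          using dist_triangle[of "T s' (V s')" "T s (V s)" "T s' (V s)"] by (simp add: V[OF s] V[OF s'])
        ultimately have "dist (V s') (V s) \<le> dist s' s * (2 * B)" by simp
        also have "\<dots> \<le> dist s' s * (2 * B + 1)" by (intro mult_left_mono) auto
        also have "\<dots> < e" using d B0 by (simp add: field_simps)
        finally show ?thesis .
      qed
      then show "\<exists>d>0. \<forall>s'\<in>{0..S}. dist s' s < d \<longrightarrow> dist (V s') (V s) < e"
        using e B0 by (intro exI[of _ "e / (2 * B + 1)"]) auto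
    qed
    have "continuous_on {0..S} (\<lambda>s. apply_bcontfun (V s) b)"
      unfolding continuous_on_iff
    proof (intro ballI allI impI)
      fix s e :: real assume "s \<in> {0..S}" "e > 0"
      then obtain d where d: "d > 0" "\<forall>s'\<in>{0..S}. dist s' s < d \<longrightarrow> dist (V s') (V s) < e"
        using cV unfolding continuous_on_iff by blast
      then show "\<exists>d>0. \<forall>s'\<in>{0..S}. dist s' s < d \<longrightarrow> dist (apply_bcontfun (V s') b) (apply_bcontfun (V s) b) < e"
        using le_less_trans[OF dist_bounded] by blast
    qed
    then have "continuous_on {0..S} (\<lambda>s. exp (\<beta> * (b - a)) * apply_bcontfun (V s) b)"
      by (intro continuous_intros)
    then show "continuous_on {0..S} (\<lambda>s. \<theta> s b)"
      by (rule continuous_on_eq) (use VT ab in auto)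
  qed
qed

section \<open>The Pruefer angle and the choice of the parameter by its end value\<close>

lemma sin_squared_lipschitz: "\<bar>(sin x)\<^sup>2 - (sin y)\<^sup>2\<bar> \<le> 2 * \<bar>x - y\<bar>" for x y :: real
proof -
  have "norm ((sin x)\<^sup>2 - (sin y)\<^sup>2) \<le> 2 * norm (x - y)"
  proof (rule field_differentiable_bound[of UNIV "\<lambda>x. (sin x)\<^sup>2" "\<lambda>x. 2 * sin x * cos x"])
    show "((\<lambda>x. (sin x)\<^sup>2) has_real_derivative 2 * sin z * cos z) (at z within UNIV)" for z :: real
      by (auto intro!: derivative_eq_intros)
    show "norm (2 * sin z * cos z) \<le> 2" for z :: real
      using mult_mono[OF abs_sin_le_one abs_cos_le_one, of z z] by (simp add: abs_mult)
  qed auto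
  then show ?thesis by simp
qed

text \<open>The factor \<open>s\<close> of the angle equation is left outside: the solution theorem
  treats equations in which the parameter multiplies a right-hand side independent of it.\<close>

definition pruefer_rhs :: "(real \<Rightarrow> real) \<Rightarrow> real \<Rightarrow> real \<Rightarrow> real" where
  "pruefer_rhs E t x = E t * (cos x)\<^sup>2 + (sin x)\<^sup>2 / E t"

text \<open>
  The Pruefer amplitude \<open>\<rho>\<close> solves \<open>\<rho>' = s (E - 1/E) \<rho> sin \<theta> cos \<theta>\<close>; then \<open>e = \<rho> sin \<theta>\<close> and \<open>g = s \<rho> cos \<theta>\<close>.
\<close>

lemma sturm_liouville_pruefer:
  assumes ab: "a < b" and E: "continuous_on {a..b} E" "\<And>t. E t > 0"
    and \<theta>: "\<And>t. t \<in> {a..b} \<Longrightarrow> (\<theta> has_real_derivative s * pruefer_rhs E t (\<theta> t)) (at t within {a..b})"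
    and \<theta>a: "\<theta> a = 0" and \<theta>b: "\<theta> b = real n * pi" and n: "n \<ge> 1"
  shows "\<exists>e g. sturm_liouville a b E (- s\<^sup>2 / 2) e g"
proof -
  define F where "F t = 1 / E t" for t
  have E0: "E t \<noteq> 0" for t using E(2)[of t] by linarith
  have cF: "continuous_on {a..b} F" unfolding F_def using E(1) E0 by (intro continuous_intros) auto
  have c\<theta>: "continuous_on {a..b} \<theta>" using \<theta> by (rule DERIV_continuous_on)
  define u where "u t = s * (E t - F t) * sin (\<theta> t) * cos (\<theta> t)" for t
  have cu: "continuous_on {a..b} u" unfolding u_def using E(1) cF c\<theta> by (intro continuous_intros)
  define \<rho> where "\<rho> t = exp (integral {a..t} u)" for t
  define e where "e t = \<rho> t * sin (\<theta> t)" for t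
  define g where "g t = s * \<rho> t * cos (\<theta> t)" for t
  have d\<rho>: "(\<rho> has_real_derivative \<rho> t * u t) (at t within {a..b})" if "t \<in> {a..b}" for t
    unfolding \<rho>_def using integral_has_real_derivative[OF cu that] by (auto intro!: derivative_eq_intros)
  have d\<theta>: "(\<theta> has_real_derivative s * (E t * (cos (\<theta> t))\<^sup>2 + (sin (\<theta> t))\<^sup>2 * F t)) (at t within {a..b})"
    if "t \<in> {a..b}" for t
    using \<theta>[OF that] by (simp add: pruefer_rhs_def F_def)
  have de: "(e has_real_derivative E t * g t) (at t within {a..b})" if t: "t \<in> {a..b}" for t
  proof -
    have "(e has_real_derivative \<rho> t * u t * sin (\<theta> t)
        + \<rho> t * (cos (\<theta> t) * (s * (E t * (cos (\<theta> t))\<^sup>2 + (sin (\<theta> t))\<^sup>2 * F t)))) (at t within {a..b})"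
      unfolding e_def by (auto intro!: derivative_eq_intros d\<rho>[OF t] d\<theta>[OF t])
    \<comment> \<open>The choice of \<open>u\<close> makes the terms with \<open>F\<close> cancel,
      and those with \<open>E\<close> combine to a multiple of
      \<open>sin\<^sup>2 + cos\<^sup>2\<close>.\<close>
    also have "\<rho> t * u t * sin (\<theta> t) + \<rho> t * (cos (\<theta> t) * (s * (E t * (cos (\<theta> t))\<^sup>2 + (sin (\<theta> t))\<^sup>2 * F t)))
        = E t * (s * \<rho> t * cos (\<theta> t)) * ((sin (\<theta> t))\<^sup>2 + (cos (\<theta> t))\<^sup>2)"
      unfolding u_def by algebra
    finally show ?thesis by (simp add: g_def)
  qed
  have dg: "(g has_real_derivative 2 * (- s\<^sup>2 / 2) * e t / E t) (at t within {a..b})" if t: "t \<in> {a..b}" for t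
  proof -
    have "(g has_real_derivative s * (\<rho> t * u t) * cos (\<theta> t)
        + s * \<rho> t * (- sin (\<theta> t) * (s * (E t * (cos (\<theta> t))\<^sup>2 + (sin (\<theta> t))\<^sup>2 * F t)))) (at t within {a..b})"
      unfolding g_def by (auto intro!: derivative_eq_intros d\<rho>[OF t] d\<theta>[OF t])
    \<comment> \<open>Here the terms with \<open>E\<close> cancel and those with \<open>F\<close>
      survive.\<close>
    also have "s * (\<rho> t * u t) * cos (\<theta> t)
        + s * \<rho> t * (- sin (\<theta> t) * (s * (E t * (cos (\<theta> t))\<^sup>2 + (sin (\<theta> t))\<^sup>2 * F t)))
        = - (s\<^sup>2) * (\<rho> t * sin (\<theta> t)) * F t * ((sin (\<theta> t))\<^sup>2 + (cos (\<theta> t))\<^sup>2)"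
      unfolding u_def by algebra
    finally show ?thesis by (simp add: e_def F_def)
  qed
  \<comment> \<open>Nontriviality: as \<open>n \<ge> 1\<close>, the angle passes through
    \<open>pi / 2\<close>, where \<open>e\<close> equals the positive amplitude.\<close>
  have "\<theta> a \<le> pi / 2" "pi / 2 \<le> \<theta> b"
    using n mult_right_mono[of 1 "real n" pi] pi_gt_zero unfolding \<theta>a \<theta>b by simp_all
  then obtain t where t: "a \<le> t" "t \<le> b" "\<theta> t = pi / 2"
    using IVT'[of \<theta> a "pi / 2" b] ab c\<theta> by auto
  have "e t \<noteq> 0" by (simp add: e_def \<rho>_def t(3) del: eq_divide_eq_numeral1)
  moreover have "e a = 0" "e b = 0" by (simp_all add: e_def \<theta>a \<theta>b)
  ultimately have "sturm_liouville a b E (- s\<^sup>2 / 2) e g"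
    unfolding sturm_liouville_def using de dg t by auto
  then show ?thesis by blast
qed

theorem infinite_sturm_liouville:
  assumes ab: "a < b" and E: "continuous_on {a..b} E" "\<And>t. E t > 0"
  shows "infinite {l. \<exists>e g. sturm_liouville a b E l e g}" (is "infinite ?L")
proof
  assume fin: "finite ?L"
  \<comment> \<open>One more than the supposed number of eigenvalues; the values
    \<open>n = 1, ..., N\<close> will produce too many.\<close>
  define N where "N = Suc (card ?L)"
  have E0: "E t \<noteq> 0" for t using E(2)[of t] by linarith
  obtain x1 x2 where x: "x1 \<in> {a..b}" "x2 \<in> {a..b}"
    and mM: "\<And>t. t \<in> {a..b} \<Longrightarrow> E x1 \<le> E t" "\<And>t. t \<in> {a..b} \<Longrightarrow> E t \<le> E x2"
    using continuous_attains_inf[of "{a..b}" E] continuous_attains_sup[of "{a..b}" E] E(1) ab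
    by (metis atLeastatMost_empty_iff compact_Icc less_imp_le not_le)
  \<comment> \<open>The right-hand side is a convex combination of \<open>E t\<close> and
    \<open>1 / E t\<close> with weights \<open>cos\<^sup>2\<close> and \<open>sin\<^sup>2\<close>,
    so the smaller of their lower bounds on \<open>[a, b]\<close> bounds it below.\<close>
  define c where "c = min (E x1) (1 / E x2)"
  have c: "c > 0" unfolding c_def using E(2) by simp
  have G_ge: "pruefer_rhs E t y \<ge> c" if t: "t \<in> {a..b}" for t y
  proof -
    have "c \<le> E t" using mM(1)[OF t] by (simp add: c_def)
    moreover have "1 / E x2 \<le> 1 / E t" using mM(2)[OF t] E(2) by (simp add: frac_le)
    then have "c \<le> 1 / E t" by (simp add: c_def)
    ultimately have "c * (cos y)\<^sup>2 + c * (sin y)\<^sup>2 \<le> E t * (cos y)\<^sup>2 + 1 / E t * (sin y)\<^sup>2"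
      by (intro add_mono mult_right_mono) auto
    moreover have "c * (cos y)\<^sup>2 + c * (sin y)\<^sup>2 = c"
      by (metis distrib_left mult.right_neutral sin_cos_squared_add2)
    ultimately show ?thesis by (simp add: pruefer_rhs_def)
  qed
  \<comment> \<open>Writing the right-hand side as \<open>E + (1/E - E) * sin\<^sup>2\<close> leaves
    the Lipschitz constant 2 of \<open>sin\<^sup>2\<close> times a bound for
    \<open>\<bar>1/E - E\<bar>\<close>.\<close>
  define K where "K = 2 * (1 / E x1 + E x2)"
  have K: "K \<ge> 0" unfolding K_def using E(2)[of x1] E(2)[of x2] by simp
  have lip: "\<bar>pruefer_rhs E t y - pruefer_rhs E t z\<bar> \<le> K * \<bar>y - z\<bar>" if t: "t \<in> {a..b}" for t y z
  proof -
    have G: "pruefer_rhs E t y = E t + (1 / E t - E t) * (sin y)\<^sup>2" for y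
      unfolding pruefer_rhs_def cos_squared_eq by (simp add: algebra_simps)
    have "1 / E t \<le> 1 / E x1" using mM(1)[OF t] E(2) by (simp add: frac_le)
    moreover have "0 < 1 / E t" "0 < E t" using E(2) by auto
    ultimately have *: "\<bar>1 / E t - E t\<bar> \<le> 1 / E x1 + E x2" using mM(2)[OF t] by linarith
    have "\<bar>pruefer_rhs E t y - pruefer_rhs E t z\<bar> = \<bar>1 / E t - E t\<bar> * \<bar>(sin y)\<^sup>2 - (sin z)\<^sup>2\<bar>"
      unfolding G by (simp add: abs_mult[symmetric] right_diff_distrib)
    also have "\<dots> \<le> (1 / E x1 + E x2) * (2 * \<bar>y - z\<bar>)"
      using * sin_squared_lipschitz[of y z] by (intro mult_mono) auto
    also have "\<dots> = K * \<bar>y - z\<bar>" unfolding K_def by (simp only: mult_ac)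
    finally show ?thesis .
  qed
  have cG: "continuous_on ({a..b} \<times> UNIV) (\<lambda>(t, y). pruefer_rhs E t y)"
  proof -
    have cE: "continuous_on ({a..b} \<times> UNIV) (\<lambda>p::real \<times> real. E (fst p))"
      by (rule continuous_on_compose2[OF E(1)]) (auto intro!: continuous_intros)
    show ?thesis
      unfolding pruefer_rhs_def split_beta using E0 by (intro continuous_intros cE) auto
  qed
  \<comment> \<open>The angle at \<open>b\<close> is at least \<open>s * c * (b - a)\<close>, and
    this equals \<open>N * pi\<close> at \<open>s = S\<close>.\<close>
  define S where "S = real N * pi / (c * (b - a))"
  have S: "S \<ge> 0" unfolding S_def using c ab by simp
  obtain \<theta> where \<theta>a: "\<And>s. s \<in> {0..S} \<Longrightarrow> \<theta> s a = 0"
    and \<theta>: "\<And>s t. s \<in> {0..S} \<Longrightarrow> t \<in> {a..b} \<Longrightarrow>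
      (\<theta> s has_real_derivative s * pruefer_rhs E t (\<theta> s t)) (at t within {a..b})"
    and \<theta>c: "continuous_on {0..S} (\<lambda>s. \<theta> s b)"
    using ode_solution_continuous_in_parameter[OF ab cG lip K S] by metis
  have I: "((\<lambda>t. s * pruefer_rhs E t (\<theta> s t)) has_integral \<theta> s b) {a..b}" if s: "s \<in> {0..S}" for s
  proof -
    have "((\<lambda>t. s * pruefer_rhs E t (\<theta> s t)) has_integral \<theta> s b - \<theta> s a) {a..b}"
      using ab \<theta>[OF s] by (intro fundamental_theorem_of_calculus)
        (auto simp: has_real_derivative_iff_has_vector_derivative[symmetric])
    then show ?thesis using \<theta>a[OF s] by simp
  qed
  have \<theta>0: "\<theta> 0 b = 0" using I[of 0] S by (simp add: has_integral_0_eq)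
  have \<theta>S: "real N * pi \<le> \<theta> S b"
  proof (rule has_integral_le)
    have "((\<lambda>t. S * c) has_integral measure lborel {a..b} *\<^sub>R (S * c)) {a..b}" by (rule has_integral_const_real)
    moreover have "measure lborel {a..b} *\<^sub>R (S * c) = real N * pi" using ab c by (simp add: S_def)
    ultimately show "((\<lambda>t. S * c) has_integral real N * pi) {a..b}" by simp
    show "((\<lambda>t. S * pruefer_rhs E t (\<theta> S t)) has_integral \<theta> S b) {a..b}" using S by (intro I) simp
    show "S * c \<le> S * pruefer_rhs E t (\<theta> S t)" if "t \<in> {a..b}" for t
      using S G_ge[OF that] by (rule mult_left_mono[rotated])
  qed
  have "\<exists>s. s \<in> {0..S} \<and> \<theta> s b = real n * pi" if n: "n \<le> N" for n
  proof -
    have "real n * pi \<le> real N * pi" using n by simp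
    then have "real n * pi \<le> \<theta> S b" using \<theta>S by (rule order_trans)
    moreover have "\<theta> 0 b \<le> real n * pi" using \<theta>0 by simp
    ultimately show ?thesis using IVT'[of "\<lambda>s. \<theta> s b" 0 "real n * pi" S] S \<theta>c by auto
  qed
  then obtain s where s: "s n \<in> {0..S}" "\<theta> (s n) b = real n * pi" if "n \<le> N" for n by metis
  have "(\<lambda>n. - (s n)\<^sup>2 / 2) ` {1..N} \<subseteq> ?L"
  proof safe
    fix n assume n: "n \<in> {1..N}"
    then have n': "n \<le> N" "n \<ge> 1" by auto
    show "\<exists>e g. sturm_liouville a b E (- (s n)\<^sup>2 / 2) e g"
      by (rule sturm_liouville_pruefer[OF ab E \<theta>[OF s(1)[OF n'(1)]] \<theta>a[OF s(1)[OF n'(1)]] s(2)[OF n'(1)] n'(2)])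
  qed
  \<comment> \<open>Since \<open>s n \<ge> 0\<close>, equal eigenvalues mean equal parameters, hence
    equal end angles \<open>n * pi\<close> and \<open>m * pi\<close>.\<close>
  moreover have "inj_on (\<lambda>n. - (s n)\<^sup>2 / 2) {1..N}"
  proof (rule inj_onI)
    fix n m assume nm: "n \<in> {1..N}" "m \<in> {1..N}" and eq: "- (s n)\<^sup>2 / 2 = - (s m)\<^sup>2 / 2"
    then have "n \<le> N" "m \<le> N" by auto
    then have "s n \<ge> 0" "s m \<ge> 0" using s(1) by auto
    moreover have "(s n)\<^sup>2 = (s m)\<^sup>2" using eq by simp
    ultimately have "s n = s m" by (rule power2_eq_imp_eq[rotated])
    then have "real n * pi = real m * pi" using s(2) \<open>n \<le> N\<close> \<open>m \<le> N\<close> by metis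
    then show "n = m" by simp
  qed
  ultimately have "card {1..N} \<le> card ?L" using fin by (metis card_image card_mono)
  then show False by (simp add: N_def)
qed

lemma weak_eigenvalues_eq:
  assumes "a < b" "continuous_on {a..b} w"
  shows "weak_eigenvalues a b w = {l. \<exists>e g. sturm_liouville a b (ito_exp w) l e g}"
  using weak_eigenvalueI[OF assms] weak_eigenvalueE[OF assms] by blast

text \<open>"A countable number" is rendered as countably infinite, hence the two conjuncts. The
  claim is proved path by path, since \<open>standard_brownian_motion\<close> provides continuity on
  \<open>T\<close> for each point of the sample space.\<close>

theorem corollary9:
  fixes M :: "'w measure" and T :: "real set" and t0 a b :: real and W :: "real \<Rightarrow> 'w \<Rightarrow> real"
  assumes "a < b"
    and "standard_brownian_motion M T t0 W"
    and "{a..b} \<subseteq> T"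
  shows "AE \<omega> in M.
    countable (weak_eigenvalues a b (\<lambda>t. W t \<omega>)) \<and> infinite (weak_eigenvalues a b (\<lambda>t. W t \<omega>))"
proof (rule AE_I2)
  fix \<omega> assume "\<omega> \<in> space M"
  then have w: "continuous_on {a..b} (\<lambda>t. W t \<omega>)"
    using assms(2,3) by (auto simp: standard_brownian_motion_def intro: continuous_on_subset)
  note E = continuous_on_ito_exp[OF w] ito_exp_pos
  show "countable (weak_eigenvalues a b (\<lambda>t. W t \<omega>)) \<and> infinite (weak_eigenvalues a b (\<lambda>t. W t \<omega>))"
    unfolding weak_eigenvalues_eq[OF assms(1) w]
    using countable_sturm_liouville[OF assms(1) E] infinite_sturm_liouville[OF assms(1) E] by blast
qed

end
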